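(* There is a universal constant $c_0>0$ such that the following holds. Let parameters $L_f,D>0$, $\kappa_A\ge1$ be given. For any integer $k\ge\kappa_A$ with $k\ge2$, set $N=\left\lfloor\frac{\kappa_A+1}2\right\rfloor$, $K=\left\lfloor\frac{k-2}{N+1}\right\rfloor+1$, $d=2K$, $\mu_f=\frac{L_f}{(K+1)^2}$. Then, for a suitable $\alpha>0$, the problem $$\min_{x\in\mathbb{R}^{2Nd}}f(x)=\sum_{i=1}^NG(x[i],x[N+i])\quad\text{s.t. }x[1]=x[2]=\cdots=x[2N],$$ $$G(u,v)=\frac{L_f-\mu_f}4\left[(\alpha-u_1)^2+\sum_{i=1}^{d-1}(v_i-u_{i+1})^2\right]+\frac{\mu_f}2\left(\|u\|^2+\|v\|^2\right),$$ belongs to the class $\mathcal F_{\mathrm C}(L_f,\kappa_A,D)$, and for this problem the $k$-th iterate $x_k$ generated by any first-order linear span algorithm (with $x_0=0$) satisfies $$f(x_k)-f(x^\star)-\langle\lambda^\star,Ax_k-b\rangle\ge c_0\cdot\frac{\kappa_A^2L_fD^2}{k^2},$$ where $\lambda^\star$ is the optimal dual variable.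
   Context: Here $x\in\mathbb{R}^{2Nd}$ is the stack of $x[1],\dots,x[2N]\in\mathbb{R}^d$; the constraint is written as $Ax=b$ with $b=0$ and $A\in\mathbb{R}^{(2N-1)d\times2Nd}$ the block matrix whose $i$-th block row gives $x[i]-x[i+1]$, $1\le i\le2N-1$. $x^\star$ is the optimal solution, and the sign convention for the dual variable is $A^{\mathrm T}\lambda^\star=\nabla f(x^\star)$. Class $\mathcal F_{\mathrm C}(L_f,\kappa_A,D)$: problems $\min_xf(x)+h(Ax-b)$ ($h$ proper closed convex; constraints $Ax=b$ correspond to $h=\mathbb I_{\{0\}}$, the indicator function of $\{0\}$) with $f$ convex and $L_f$-smooth, $\|x_0-x^\star\|\le D$, and condition number of $A$ (norm over minimal singular value) at most $\kappa_A$. First-order linear span algorithm (class $\mathcal A$) for $\min f(x)$ s.t. $Ax=b$, with $x_0=0$ (and zero initial dual variable): $x_k\in\mathcal S^x_k$ for all $k$, where $\mathcal S^x_0=\mathrm{Span}\{x_0\}$ and $\mathcal S^x_{k+1}=\mathrm{Span}\{x_i,\nabla f(\hat x_i),A^{\mathrm T}(A\hat x_i-b):\hat x_i\in\mathcal S^x_i,0\le i\le k\}$. *)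

theory Defs
  imports "HOL-Library.Extended_Real" "Jordan_Normal_Form.VS_Connect"
    "Jordan_Normal_Form.Char_Poly"
begin

text \<open>
  The dimensions of the problem depend on the parameters of the theorem, so vectors of dimension
  \<open>n\<close> are elements of the explicit carrier \<open>carrier_vec n\<close>. This type carries no topology,
  hence norm, gradient, convexity and closedness are spelled out here.
\<close>

definition vnorm :: "real vec \<Rightarrow> real" where
  "vnorm v = sqrt (v \<bullet> v)"

definition has_grad :: "nat \<Rightarrow> (real vec \<Rightarrow> real) \<Rightarrow> real vec \<Rightarrow> real vec \<Rightarrow> bool" where
  "has_grad n f x g \<longleftrightarrow> g \<in> carrier_vec n \<and>
     (\<forall>e>0. \<exists>r>0. \<forall>y\<in>carrier_vec n. vnorm (y - x) < r \<longrightarrow>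
        \<bar>f y - f x - g \<bullet> (y - x)\<bar> \<le> e * vnorm (y - x))"

definition grad :: "nat \<Rightarrow> (real vec \<Rightarrow> real) \<Rightarrow> real vec \<Rightarrow> real vec" where
  "grad n f x = (THE g. has_grad n f x g)"

definition smooth_fun :: "nat \<Rightarrow> real \<Rightarrow> (real vec \<Rightarrow> real) \<Rightarrow> bool" where
  "smooth_fun n L f \<longleftrightarrow>
     (\<forall>x\<in>carrier_vec n. \<exists>g. has_grad n f x g) \<and>
     (\<forall>x\<in>carrier_vec n. \<forall>y\<in>carrier_vec n. vnorm (grad n f x - grad n f y) \<le> L * vnorm (x - y))"

text \<open>For a function that never takes the value \<open>-\<infinity>\<close>, the convention \<open>0 * \<infinity> = 0\<close>
  at the endpoints \<open>t = 0\<close> and \<open>t = 1\<close> is harmless.\<close>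

definition convex_fun :: "nat \<Rightarrow> (real vec \<Rightarrow> ereal) \<Rightarrow> bool" where
  "convex_fun n h \<longleftrightarrow> (\<forall>x\<in>carrier_vec n. \<forall>y\<in>carrier_vec n. \<forall>t\<in>{0..1}.
     h (t \<cdot>\<^sub>v x + (1 - t) \<cdot>\<^sub>v y) \<le> ereal t * h x + ereal (1 - t) * h y)"

definition proper_fun :: "nat \<Rightarrow> (real vec \<Rightarrow> ereal) \<Rightarrow> bool" where
  "proper_fun n h \<longleftrightarrow>
     (\<forall>x\<in>carrier_vec n. h x \<noteq> -\<infinity>) \<and> (\<exists>x\<in>carrier_vec n. h x \<noteq> \<infinity>)"

text \<open>Sequential closedness of the epigraph.\<close>

definition closed_fun :: "nat \<Rightarrow> (real vec \<Rightarrow> ereal) \<Rightarrow> bool" where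
  "closed_fun n h \<longleftrightarrow> (\<forall>(Y :: nat \<Rightarrow> real vec) (T :: nat \<Rightarrow> real) y s.
     (\<forall>i. Y i \<in> carrier_vec n \<and> h (Y i) \<le> ereal (T i)) \<and> y \<in> carrier_vec n \<and>
     (\<lambda>i. vnorm (Y i - y)) \<longlonglongrightarrow> 0 \<and> T \<longlonglongrightarrow> s \<longrightarrow> h y \<le> ereal s)"

definition indicator_zero :: "nat \<Rightarrow> real vec \<Rightarrow> ereal" where
  "indicator_zero m y = (if y = 0\<^sub>v m then 0 else \<infinity>)"

definition mat_norm :: "real mat \<Rightarrow> real" where
  "mat_norm A = (SUP v\<in>{v \<in> carrier_vec (dim_col A). vnorm v \<le> 1}. vnorm (A *\<^sub>v v))"

text \<open>A matrix with \<open>r\<close> rows and \<open>c\<close> columns has \<open>min r c\<close> singular values (zero allowed): the square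
  roots of the eigenvalues of the smaller of the two Gram matrices.\<close>

definition singular_values :: "real mat \<Rightarrow> real set" where
  "singular_values A = sqrt ` {e. eigenvalue
     (if dim_row A \<le> dim_col A then A * A\<^sup>T else A\<^sup>T * A) e}"

definition min_singular_value :: "real mat \<Rightarrow> real" where
  "min_singular_value A = Min (singular_values A)"

text \<open>The condition number is infinite if the minimal singular value vanishes.\<close>

definition cond_number :: "real mat \<Rightarrow> ereal" where
  "cond_number A = (if min_singular_value A = 0 then \<infinity>
     else ereal (mat_norm A / min_singular_value A))"

definition is_solution ::
  "(real vec \<Rightarrow> real) \<Rightarrow> (real vec \<Rightarrow> ereal) \<Rightarrow> real mat \<Rightarrow> real vec \<Rightarrow> real vec \<Rightarrow> bool" where
  "is_solution f h A b x \<longleftrightarrow> x \<in> carrier_vec (dim_col A) \<and>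
     ereal (f x) + h (A *\<^sub>v x - b) < \<infinity> \<and>
     (\<forall>y\<in>carrier_vec (dim_col A).
        ereal (f x) + h (A *\<^sub>v x - b) \<le> ereal (f y) + h (A *\<^sub>v y - b))"

definition class_FC :: "real \<Rightarrow> real \<Rightarrow> real \<Rightarrow>
  (real vec \<Rightarrow> real) \<Rightarrow> (real vec \<Rightarrow> ereal) \<Rightarrow> real mat \<Rightarrow> real vec \<Rightarrow> real vec \<Rightarrow> bool" where
  "class_FC L kappa D f h A b x0 \<longleftrightarrow>
     b \<in> carrier_vec (dim_row A) \<and> x0 \<in> carrier_vec (dim_col A) \<and>
     convex_fun (dim_col A) (\<lambda>x. ereal (f x)) \<and> smooth_fun (dim_col A) L f \<and>
     proper_fun (dim_row A) h \<and> closed_fun (dim_row A) h \<and> convex_fun (dim_row A) h \<and>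
     (\<exists>xs. is_solution f h A b xs \<and> vnorm (x0 - xs) \<le> D) \<and>
     cond_number A \<le> ereal kappa"

text \<open>Lagrange dual of minimising \<open>f x\<close> subject to \<open>A x = b\<close>. The multiplier enters the Lagrangian
  with a minus sign, so that stationarity reads \<open>A\<^sup>T \<lambda> = \<nabla>f(x)\<close>.\<close>

definition dual_fun ::
  "(real vec \<Rightarrow> real) \<Rightarrow> real mat \<Rightarrow> real vec \<Rightarrow> real vec \<Rightarrow> ereal" where
  "dual_fun f A b l = (INF x\<in>carrier_vec (dim_col A). ereal (f x - l \<bullet> (A *\<^sub>v x - b)))"

definition is_dual_solution ::
  "(real vec \<Rightarrow> real) \<Rightarrow> real mat \<Rightarrow> real vec \<Rightarrow> real vec \<Rightarrow> bool" where
  "is_dual_solution f A b l \<longleftrightarrow> l \<in> carrier_vec (dim_row A) \<and>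
     (\<forall>l'\<in>carrier_vec (dim_row A). dual_fun f A b l' \<le> dual_fun f A b l)"

abbreviation vspan :: "nat \<Rightarrow> real vec set \<Rightarrow> real vec set" where
  "vspan n \<equiv> LinearCombinations.module.span class_ring (module_vec TYPE(real) n)"

fun span_sets :: "(real vec \<Rightarrow> real) \<Rightarrow> real mat \<Rightarrow> real vec \<Rightarrow> (nat \<Rightarrow> real vec) \<Rightarrow>
    nat \<Rightarrow> real vec set" where
  "span_sets f A b x 0 = vspan (dim_col A) {x 0}"
| "span_sets f A b x (Suc k) = vspan (dim_col A)
     (\<Union>i\<in>{..k}. {x i} \<union> grad (dim_col A) f ` span_sets f A b x i
               \<union> (\<lambda>y. A\<^sup>T *\<^sub>v (A *\<^sub>v y - b)) ` span_sets f A b x i)"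

text \<open>The iterate sequences that first-order linear span algorithms can produce from the starting point \<open>0\<close>.\<close>

definition linear_span_iterates ::
  "(real vec \<Rightarrow> real) \<Rightarrow> real mat \<Rightarrow> real vec \<Rightarrow> (nat \<Rightarrow> real vec) \<Rightarrow> bool" where
  "linear_span_iterates f A b x \<longleftrightarrow>
     x 0 = 0\<^sub>v (dim_col A) \<and> (\<forall>k. x k \<in> span_sets f A b x k)"

text \<open>Blocks are numbered from 1, the coordinates inside a block from 0: the entry \<open>x[i]\<^sub>j\<close> of the
  stacked vector is \<open>x $ ((i - 1) * d + (j - 1))\<close>.\<close>

definition block :: "nat \<Rightarrow> real vec \<Rightarrow> nat \<Rightarrow> real vec" where
  "block d x i = vec d (\<lambda>j. x $ ((i - 1) * d + j))"

definition consensus_mat :: "nat \<Rightarrow> nat \<Rightarrow> real mat" where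
  "consensus_mat N d = mat ((2 * N - 1) * d) (2 * N * d)
     (\<lambda>(r, c). if c = r then 1 else if c = r + d then -1 else 0)"

definition G_fun :: "real \<Rightarrow> real \<Rightarrow> real \<Rightarrow> nat \<Rightarrow> real vec \<Rightarrow> real vec \<Rightarrow> real" where
  "G_fun L mu alpha d u v =
     (L - mu) / 4 * ((alpha - u $ 0)^2 + (\<Sum>i=1..d-1. (v $ (i - 1) - u $ i)^2))
     + mu / 2 * ((vnorm u)^2 + (vnorm v)^2)"

definition consensus_obj :: "real \<Rightarrow> real \<Rightarrow> real \<Rightarrow> nat \<Rightarrow> nat \<Rightarrow> real vec \<Rightarrow> real" where
  "consensus_obj L mu alpha N d x =
     (\<Sum>i=1..N. G_fun L mu alpha d (block d x i) (block d x (N + i)))"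

text \<open>The rows of the matrix are the block differences, and its kernel is the consensus
  constraint.\<close>

lemma block_consensus_mat:
  assumes x: "x \<in> carrier_vec (2 * N * d)" and i: "i \<in> {1..2 * N - 1}"
  shows "block d (consensus_mat N d *\<^sub>v x) i = block d x i - block d x (i + 1)"
proof (rule eq_vecI)
  fix j assume "j < dim_vec (block d x i - block d x (i + 1))"
  then have j: "j < d" by (simp add: block_def)
  define r where "r = (i - 1) * d + j"
  have "r < (i - 1) * d + d" using j by (simp add: r_def)
  also have "\<dots> = i * d" using i by (cases i) auto
  also have "i * d \<le> (2 * N - 1) * d" using i by (intro mult_right_mono) auto
  finally have r: "r < (2 * N - 1) * d" .
  have "(2 * N - 1) * d + d = 2 * N * d" using i by (cases N) (auto simp: algebra_simps)
  then have rd: "r + d < 2 * N * d" using r by linarith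
  have ri: "r + d = i * d + j" using i by (cases i) (auto simp: r_def)
  have "(consensus_mat N d *\<^sub>v x) $ r =
      (\<Sum>c\<in>{0..<2 * N * d}. (if c = r then 1 else if c = r + d then -1 else 0) * x $ c)"
    using r x by (simp add: consensus_mat_def scalar_prod_def)
  also have "\<dots> = (\<Sum>c\<in>{0..<2 * N * d}. (if c = r then x $ c else 0) - (if c = r + d then x $ c else 0))"
    using j by (intro sum.cong) auto
  also have "\<dots> = x $ r - x $ (r + d)"
    using rd by (simp add: sum_subtractf)
  finally show "block d (consensus_mat N d *\<^sub>v x) i $ j = (block d x i - block d x (i + 1)) $ j"
    unfolding ri using j by (simp add: block_def r_def ri[unfolded r_def])
qed (simp add: block_def)

lemma consensus_mat_kernel:
  assumes x: "x \<in> carrier_vec (2 * N * d)"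
  shows "consensus_mat N d *\<^sub>v x = 0\<^sub>v ((2 * N - 1) * d) \<longleftrightarrow>
    (\<forall>i\<in>{1..2 * N}. block d x i = block d x 1)"
proof
  assume z: "consensus_mat N d *\<^sub>v x = 0\<^sub>v ((2 * N - 1) * d)"
  have step: "block d x (i + 1) = block d x i" if i: "i \<in> {1..2 * N - 1}" for i
  proof (rule eq_vecI)
    fix j assume "j < dim_vec (block d x i)"
    then have j: "j < d" by (simp add: block_def)
    have "(i - 1) * d + j < (i - 1) * d + d" using j by simp
    also have "\<dots> = i * d" using i by (cases i) auto
    also have "i * d \<le> (2 * N - 1) * d" using i by (intro mult_right_mono) auto
    finally have "block d (consensus_mat N d *\<^sub>v x) i $ j = 0"
      using j by (simp add: z block_def)
    then show "block d x (i + 1) $ j = block d x i $ j"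
      unfolding block_consensus_mat[OF x i] using j by (simp add: block_def)
  qed (simp add: block_def)
  have "Suc i \<le> 2 * N \<Longrightarrow> block d x (Suc i) = block d x 1" for i
  proof (induction i)
    case 0
    show ?case by (simp only: One_nat_def)
  next
    case (Suc i)
    from Suc.prems have "Suc i \<in> {1..2 * N - 1}" and le: "Suc i \<le> 2 * N" by simp_all
    from step[OF this(1)] have "block d x (Suc (Suc i)) = block d x (Suc i)"
      by (simp only: Suc_eq_plus1)
    with Suc.IH[OF le] show ?case by (simp only:)
  qed
  then show "\<forall>i\<in>{1..2 * N}. block d x i = block d x 1"
    by (metis One_nat_def Suc_le_D atLeastAtMost_iff)
next
  assume eq: "\<forall>i\<in>{1..2 * N}. block d x i = block d x 1"
  show "consensus_mat N d *\<^sub>v x = 0\<^sub>v ((2 * N - 1) * d)"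
  proof (rule eq_vecI)
    fix r assume "r < dim_vec (0\<^sub>v ((2 * N - 1) * d) :: real vec)"
    then have r: "r < (2 * N - 1) * d" by simp
    then have d: "0 < d" by (cases d) auto
    define i where "i = r div d + 1"
    have "r div d < 2 * N - 1" using r by (simp add: less_mult_imp_div_less)
    then have i: "i \<in> {1..2 * N - 1}" by (simp add: i_def)
    have m: "r mod d < d" using d by simp
    have "i \<in> {1..2 * N}" "i + 1 \<in> {1..2 * N}" using i by auto
    then have "block d x i = block d x (i + 1)" using eq by metis
    then have "block d (consensus_mat N d *\<^sub>v x) i $ (r mod d) = 0"
      unfolding block_consensus_mat[OF x i] using m by (simp add: block_def)
    then show "(consensus_mat N d *\<^sub>v x) $ r = 0\<^sub>v ((2 * N - 1) * d) $ r"
      using m r by (simp add: block_def i_def)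
  qed (simp add: consensus_mat_def)
qed

end

theory Submission
  imports Defs
begin

text \<open>
  The objective is quadratic, so the left-hand side of the bound is the value at \<open>x\<^sub>k - x\<^sup>*\<close> of its
  quadratic form, hence at least \<open>\<mu>\<^sub>f / 2\<close> times the squared distance to \<open>x\<^sup>*\<close>. Coordinate \<open>j\<close> of
  a block \<open>v\<close> can only excite coordinate \<open>j + 1\<close> of the partner block \<open>u\<close>, which lies \<open>N\<close> blocks away
  along the path graph of the constraint; as one application of \<open>A\<^sup>T A\<close> advances a single block, after
  \<open>k\<close> iterations only the first \<open>K\<close> of the \<open>2 K\<close> coordinates of the last \<open>N\<close> blocks can be nonzero.
  The blocks of \<open>x\<^sup>*\<close> decay geometrically with ratio \<open>K / (K + 2)\<close>, so the other \<open>K\<close> coordinates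
  retain a constant fraction of \<open>\<parallel>x\<^sup>*\<parallel>\<^sup>2 = D\<^sup>2\<close>.
\<close>

section \<open>Quadratic objectives under linear constraints\<close>

text \<open>Two demands compete. A long path slows propagation, but its condition number grows with
  its length and may not exceed \<open>kappa\<close>, not even for \<open>kappa = 1\<close>.
  Asymptotic spectral bounds are therefore not enough: for \<open>N = 1\<close> norm and smallest
  singular value must both be estimated without loss, while for larger \<open>N\<close> there is
  room for cruder constants.

  With \<open>N\<close> of order \<open>kappa\<close>, the detour of \<open>N + 1\<close> iterations
  per coordinate leaves \<open>K\<close> of order \<open>k / kappa\<close>. The parameter
  \<open>mu\<close> has to be of order \<open>L / K^2\<close>: a larger value would make the
  solution decay too much over \<open>K\<close> coordinates, a smaller one would weaken the strong
  convexity that yields the bound. The value \<open>L / (K + 1)^2\<close> also makes the decay ratio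
  rational. The result is of order \<open>mu * D^2\<close>, that is
  \<open>L * D^2 * kappa^2 / k^2\<close>.

  The scale of the problem is set by \<alpha> alone, since the solution depends linearly on it; this
  is how the distance \<open>D\<close> is met exactly.\<close>

lemma vnorm_power2: "(vnorm v)\<^sup>2 = v \<bullet> v"
  by (simp add: vnorm_def scalar_prod_def sum_nonneg)

lemma vnorm_nonneg: "0 \<le> vnorm v"
  by (simp add: vnorm_def scalar_prod_def sum_nonneg)

lemma vnorm_le_iff: "0 \<le> c \<Longrightarrow> vnorm v \<le> c * vnorm w \<longleftrightarrow> v \<bullet> v \<le> c\<^sup>2 * (w \<bullet> w)"
  by (metis abs_le_square_iff abs_of_nonneg mult_nonneg_nonneg power_mult_distrib vnorm_nonneg
      vnorm_power2)

lemma scalar_prod_lessThan: "w \<in> carrier_vec n \<Longrightarrow> v \<bullet> w = (\<Sum>r<n. v $ r * w $ r)"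
  by (simp add: scalar_prod_def lessThan_atLeast0)

lemma scalar_prod_self_eq_0:
  fixes v :: "real vec"
  assumes "v \<in> carrier_vec n"
  shows "v \<bullet> v = 0 \<longleftrightarrow> v = 0\<^sub>v n"
proof
  assume "v \<bullet> v = 0"
  then have "(\<Sum>r<n. v $ r * v $ r) = 0" using assms by (simp add: scalar_prod_lessThan)
  then have "\<forall>r\<in>{..<n}. v $ r * v $ r = 0"
    by (subst (asm) sum_nonneg_eq_0_iff) auto
  then show "v = 0\<^sub>v n" using assms by (intro eq_vecI) auto
qed (simp add: scalar_prod_lessThan)

lemma scalar_prod_self_nonneg: "0 \<le> (v :: real vec) \<bullet> v"
  by (simp add: scalar_prod_def sum_nonneg)

lemma vnorm_eq_0: "v \<in> carrier_vec n \<Longrightarrow> vnorm v = 0 \<longleftrightarrow> v = 0\<^sub>v n"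
  by (simp add: vnorm_def scalar_prod_self_eq_0)

lemma scalar_prod_diff_self:
  fixes v w :: "real vec"
  assumes "v \<in> carrier_vec n" "w \<in> carrier_vec n"
  shows "(v - w) \<bullet> (v - w) = (w - v) \<bullet> (w - v)"
  using assms by (auto simp: scalar_prod_def algebra_simps intro!: sum.cong)

lemma add_diff_vec: "x \<in> carrier_vec n \<Longrightarrow> y \<in> carrier_vec n \<Longrightarrow> x + (y - x) = (y :: real vec)"
  by (intro eq_vecI) auto

lemma diff_vec_eq_0:
  fixes v w :: "real vec"
  assumes "v \<in> carrier_vec n" "w \<in> carrier_vec n"
  shows "v - w = 0\<^sub>v n \<longleftrightarrow> v = w"
  using assms by (auto simp: vec_eq_iff)

text \<open>Two gradients are compared along their own difference \<open>w\<close>: the linear terms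
  then differ by \<open>s * (w \<bullet> w)\<close>, while the two error terms with
  \<open>e = vnorm w / 4\<close> allow only half of that. Uniqueness is what gives the definite
  description in \<open>grad\<close> a value.\<close>

lemma has_grad_unique:
  assumes g: "has_grad n f x g" and g': "has_grad n f x g'" and x: "x \<in> carrier_vec n"
  shows "g = g'"
proof (rule ccontr)
  assume ne: "g \<noteq> g'"
  have gc: "g \<in> carrier_vec n" "g' \<in> carrier_vec n" using g g' by (auto simp: has_grad_def)
  define w where "w = g - g'"
  have w: "w \<in> carrier_vec n" using gc by (simp add: w_def)
  have "w \<noteq> 0\<^sub>v n" using ne gc by (simp add: w_def diff_vec_eq_0)
  then have pos: "0 < vnorm w" using vnorm_eq_0[OF w] vnorm_nonneg[of w] by linarith
  define e where "e = vnorm w / 4"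
  have e: "e > 0" using pos by (simp add: e_def)
  obtain r where r: "r > 0" "\<And>y. y \<in> carrier_vec n \<Longrightarrow> vnorm (y - x) < r \<Longrightarrow>
      \<bar>f y - f x - g \<bullet> (y - x)\<bar> \<le> e * vnorm (y - x)"
    using g e unfolding has_grad_def by blast
  obtain r' where r': "r' > 0" "\<And>y. y \<in> carrier_vec n \<Longrightarrow> vnorm (y - x) < r' \<Longrightarrow>
      \<bar>f y - f x - g' \<bullet> (y - x)\<bar> \<le> e * vnorm (y - x)"
    using g' e unfolding has_grad_def by blast
  define s where "s = min r r' / (2 * vnorm w)"
  have s: "s > 0" using r r' pos by (simp add: s_def)
  define y where "y = x + s \<cdot>\<^sub>v w"
  have y: "y \<in> carrier_vec n" using x w by (simp add: y_def)
  have yx: "y - x = s \<cdot>\<^sub>v w" using x w by (intro eq_vecI) (auto simp: y_def)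
  have ny: "vnorm (y - x) = s * vnorm w"
    using s w by (simp add: yx vnorm_def real_sqrt_mult)
  also have "\<dots> = min r r' / 2" using pos by (simp add: s_def)
  finally have "vnorm (y - x) < r" "vnorm (y - x) < r'" using r(1) r'(1) by auto
  then have "\<bar>g \<bullet> (y - x) - g' \<bullet> (y - x)\<bar> \<le> 2 * e * vnorm (y - x)"
    using r(2)[OF y] r'(2)[OF y] by linarith
  moreover have "g \<bullet> (y - x) - g' \<bullet> (y - x) = s * (w \<bullet> w)"
    using gc w by (simp add: yx w_def minus_scalar_prod_distrib right_diff_distrib)
  ultimately have "s * (vnorm w)\<^sup>2 \<le> 2 * e * (s * vnorm w)"
    unfolding ny vnorm_power2 by linarith
  then have "s * vnorm w * vnorm w \<le> s * vnorm w * (vnorm w / 2)"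
    by (simp add: e_def power2_eq_square algebra_simps)
  then show False using s pos by simp
qed

text \<open>A quadratic objective is handled only through its second-order expansion, with \<open>Q\<close> the
  quadratic form of half the Hessian.\<close>

locale quadratic_objective =
  fixes n :: nat and f :: "real vec \<Rightarrow> real" and g :: "real vec \<Rightarrow> real vec"
    and Q :: "real vec \<Rightarrow> real" and L mu :: real
  assumes L_pos: "0 < L" and mu_pos: "0 < mu"
    and g_carrier [simp]: "x \<in> carrier_vec n \<Longrightarrow> g x \<in> carrier_vec n"
    and expand: "x \<in> carrier_vec n \<Longrightarrow> w \<in> carrier_vec n \<Longrightarrow> f (x + w) = f x + g x \<bullet> w + Q w"
    and Q_lower: "w \<in> carrier_vec n \<Longrightarrow> mu / 2 * (w \<bullet> w) \<le> Q w"
    and Q_upper: "w \<in> carrier_vec n \<Longrightarrow> Q w \<le> L / 2 * (w \<bullet> w)"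
begin

lemma expand_diff:
  "x \<in> carrier_vec n \<Longrightarrow> y \<in> carrier_vec n \<Longrightarrow> f y = f x + g x \<bullet> (y - x) + Q (y - x)"
  using expand[of x "y - x"] by (simp add: add_diff_vec)

lemma Q_nonneg: "w \<in> carrier_vec n \<Longrightarrow> 0 \<le> Q w"
  using Q_lower[of w] mu_pos scalar_prod_self_nonneg[of w]
  by (meson order_trans less_imp_le half_gt_zero mult_nonneg_nonneg)

lemma has_grad:
  assumes x: "x \<in> carrier_vec n"
  shows "has_grad n f x (g x)"
  unfolding has_grad_def
proof (intro conjI allI impI)
  fix e :: real assume e: "e > 0"
  show "\<exists>r>0. \<forall>y\<in>carrier_vec n. vnorm (y - x) < r \<longrightarrow>
      \<bar>f y - f x - g x \<bullet> (y - x)\<bar> \<le> e * vnorm (y - x)"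
  proof (intro exI[of _ "2 * e / L"] conjI ballI impI)
    fix y assume y: "y \<in> carrier_vec n" and small: "vnorm (y - x) < 2 * e / L"
    have yx: "y - x \<in> carrier_vec n" using x y by simp
    have "\<bar>f y - f x - g x \<bullet> (y - x)\<bar> = Q (y - x)"
      using expand_diff[OF x y] Q_nonneg[OF yx] by simp
    also have "\<dots> \<le> L / 2 * vnorm (y - x) * vnorm (y - x)"
      using Q_upper[OF yx] by (simp add: vnorm_power2[symmetric] power2_eq_square)
    also have "\<dots> \<le> e * vnorm (y - x)"
      using small L_pos by (intro mult_right_mono vnorm_nonneg) (simp add: field_simps)
    finally show "\<bar>f y - f x - g x \<bullet> (y - x)\<bar> \<le> e * vnorm (y - x)" .
  qed (use e L_pos in simp)
qed (use x in simp)

lemma grad_eq: "x \<in> carrier_vec n \<Longrightarrow> grad n f x = g x"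
  unfolding grad_def using has_grad has_grad_unique by blast

text \<open>Positivity of \<open>Q\<close> at \<open>w + b\<close>, with \<open>b\<close> the
  gradient step \<open>- p / L\<close>, replaces an operator norm bound for the Hessian: the cross
  term contributes \<open>- (p \<bullet> p) / L\<close>, and \<open>Q b\<close> gives back at most
  half of it.\<close>

lemma gradient_lipschitz:
  assumes x: "x \<in> carrier_vec n" and y: "y \<in> carrier_vec n"
  shows "vnorm (g x - g y) \<le> L * vnorm (x - y)"
proof -
  define w where "w = x - y"
  define p where "p = g x - g y"
  define b where "b = (- 1 / L) \<cdot>\<^sub>v p"
  have w: "w \<in> carrier_vec n" and p: "p \<in> carrier_vec n" and b: "b \<in> carrier_vec n"
    using x y by (simp_all add: w_def p_def b_def)
  have x_eq: "x = y + w" unfolding w_def using x y by (simp add: add_diff_vec)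
  \<comment> \<open>Expanding at this one point from \<open>y\<close> directly and by way of
    \<open>x\<close> identifies the cross term of \<open>Q\<close> as \<open>p \<bullet> b\<close>,
    without naming a bilinear form.\<close>
  have "f (y + (w + b)) = f (x + b)"
    unfolding x_eq using y w b by (simp add: assoc_add_vec)
  then have "f y + g y \<bullet> (w + b) + Q (w + b) = f y + g y \<bullet> w + Q w + g x \<bullet> b + Q b"
    using expand[OF y, of "w + b"] expand[OF x b] expand[OF y w] w b by (simp add: x_eq)
  moreover have "g y \<bullet> (w + b) = g y \<bullet> w + g y \<bullet> b"
    using y w b by (intro scalar_prod_add_distrib) auto
  moreover have "g x \<bullet> b - g y \<bullet> b = p \<bullet> b"
    unfolding p_def using x y b by (subst minus_scalar_prod_distrib[of _ n]) auto
  ultimately have "0 \<le> Q w + p \<bullet> b + Q b"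
    using Q_nonneg[of "w + b"] w b by auto
  also have "\<dots> \<le> L / 2 * (w \<bullet> w) + p \<bullet> b + L / 2 * (b \<bullet> b)"
    using Q_upper[OF w] Q_upper[OF b] by simp
  also have "p \<bullet> b = - (p \<bullet> p) / L" using p by (simp add: b_def)
  also have "b \<bullet> b = (p \<bullet> p) / L\<^sup>2" using p by (simp add: b_def power2_eq_square)
  finally have "0 \<le> L / 2 * (w \<bullet> w) + - (p \<bullet> p) / L + L / 2 * ((p \<bullet> p) / L\<^sup>2)" .
  then have "p \<bullet> p \<le> L\<^sup>2 * (w \<bullet> w)"
    using L_pos by (simp add: field_simps power2_eq_square)
  then show ?thesis using L_pos by (simp add: vnorm_le_iff p_def w_def)
qed

lemma smooth: "smooth_fun n L f"
  unfolding smooth_fun_def using has_grad gradient_lipschitz by (auto simp: grad_eq)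

text \<open>Positivity of \<open>Q\<close> puts the graph above its tangent plane at the
  intermediate point \<open>z\<close>; in the weighted mean of the two tangent inequalities the
  linear terms cancel.\<close>

lemma convex: "convex_fun n (\<lambda>x. ereal (f x))"
  unfolding convex_fun_def
proof (intro ballI)
  fix x y :: "real vec" and t :: real
  assume x: "x \<in> carrier_vec n" and y: "y \<in> carrier_vec n" and t: "t \<in> {0..1}"
  define z where "z = t \<cdot>\<^sub>v x + (1 - t) \<cdot>\<^sub>v y"
  have z: "z \<in> carrier_vec n" using x y by (simp add: z_def)
  have "f z + g z \<bullet> (x - z) \<le> f x" "f z + g z \<bullet> (y - z) \<le> f y"
    using expand_diff[OF z x] expand_diff[OF z y] Q_nonneg[of "x - z"] Q_nonneg[of "y - z"] x y z
    by auto
  then have "t * (f z + g z \<bullet> (x - z)) + (1 - t) * (f z + g z \<bullet> (y - z)) \<le> t * f x + (1 - t) * f y"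
    using t by (intro add_mono mult_left_mono) auto
  moreover have "t * (g z \<bullet> (x - z)) + (1 - t) * (g z \<bullet> (y - z)) = 0"
  proof -
    have "t * (g z \<bullet> (x - z)) + (1 - t) * (g z \<bullet> (y - z)) =
        g z \<bullet> (t \<cdot>\<^sub>v (x - z) + (1 - t) \<cdot>\<^sub>v (y - z))"
      using x y z by (subst scalar_prod_add_distrib[of _ n]) auto
    also have "t \<cdot>\<^sub>v (x - z) + (1 - t) \<cdot>\<^sub>v (y - z) = 0\<^sub>v n"
      using x y by (intro eq_vecI) (auto simp: z_def algebra_simps)
    finally show ?thesis using z by simp
  qed
  ultimately have "f z \<le> t * f x + (1 - t) * f y" by (simp add: algebra_simps)
  then show "ereal (f (t \<cdot>\<^sub>v x + (1 - t) \<cdot>\<^sub>v y)) \<le> ereal t * ereal (f x) + ereal (1 - t) * ereal (f y)"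
    by (simp add: z_def)
qed

end

section \<open>The indicator function of the origin\<close>

lemma proper_indicator_zero: "proper_fun m (indicator_zero m)"
  unfolding proper_fun_def indicator_zero_def by (auto intro!: bexI[of _ "0\<^sub>v m"])

lemma closed_indicator_zero: "closed_fun m (indicator_zero m)"
  unfolding closed_fun_def
proof (intro allI impI)
  fix Y :: "nat \<Rightarrow> real vec" and T :: "nat \<Rightarrow> real" and y s
  assume *: "(\<forall>i. Y i \<in> carrier_vec m \<and> indicator_zero m (Y i) \<le> ereal (T i)) \<and>
    y \<in> carrier_vec m \<and> (\<lambda>i. vnorm (Y i - y)) \<longlonglongrightarrow> 0 \<and> T \<longlonglongrightarrow> s"
  have Y: "Y i = 0\<^sub>v m" for i
    using * by (auto simp: indicator_zero_def split: if_splits dest!: spec[of _ i])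
  then have T: "0 \<le> T i" for i
    using * by (auto simp: indicator_zero_def zero_ereal_def split: if_splits dest!: spec[of _ i])
  have y: "y \<in> carrier_vec m" using * by blast
  have "(\<lambda>i::nat. vnorm (0\<^sub>v m - y)) \<longlonglongrightarrow> 0" using * unfolding Y by blast
  then have "vnorm (0\<^sub>v m - y) = 0" by (simp add: LIMSEQ_const_iff)
  then have "0\<^sub>v m - y = 0\<^sub>v m" using y by (subst (asm) vnorm_eq_0) auto
  then have "y = 0\<^sub>v m" using y by (auto simp: vec_eq_iff)
  moreover have "0 \<le> s" using * T by (intro LIMSEQ_le_const[of T s]) auto
  ultimately show "indicator_zero m y \<le> ereal s" by (simp add: indicator_zero_def)
qed

text \<open>The endpoints are separate because \<open>0 * \<infinity> = 0\<close> drops a term on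
  the right there. Strictly in between, the right-hand side is infinite unless both points are
  zero.\<close>

lemma convex_indicator_zero: "convex_fun m (indicator_zero m)"
  unfolding convex_fun_def
proof (intro ballI)
  fix x y :: "real vec" and t :: real
  assume x: "x \<in> carrier_vec m" and y: "y \<in> carrier_vec m" and t: "t \<in> {0..1}"
  have "t = 0 \<or> t = 1 \<or> (0 < t \<and> t < 1)" using t by auto
  then show "indicator_zero m (t \<cdot>\<^sub>v x + (1 - t) \<cdot>\<^sub>v y)
      \<le> ereal t * indicator_zero m x + ereal (1 - t) * indicator_zero m y"
  proof (elim disjE)
    assume "t = 0"
    moreover have "0 \<cdot>\<^sub>v x + 1 \<cdot>\<^sub>v y = y" using x y by (intro eq_vecI) auto
    ultimately show ?thesis by (simp flip: zero_ereal_def one_ereal_def)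
  next
    assume "t = 1"
    moreover have "1 \<cdot>\<^sub>v x + 0 \<cdot>\<^sub>v y = x" using x y by (intro eq_vecI) auto
    ultimately show ?thesis by (simp flip: zero_ereal_def one_ereal_def)
  next
    assume "0 < t \<and> t < 1"
    moreover have "t \<cdot>\<^sub>v 0\<^sub>v m + (1 - t) \<cdot>\<^sub>v 0\<^sub>v m = (0\<^sub>v m :: real vec)" by (intro eq_vecI) auto
    ultimately show ?thesis by (auto simp: indicator_zero_def)
  qed
qed

section \<open>Primal and dual optimality from a stationary pair\<close>

locale constrained_quadratic = quadratic_objective +
  fixes m :: nat and A :: "real mat" and xs ls :: "real vec"
  assumes A_carrier: "A \<in> carrier_mat m n"
    and transpose_inj: "l \<in> carrier_vec m \<Longrightarrow> A\<^sup>T *\<^sub>v l = 0\<^sub>v n \<Longrightarrow> l = 0\<^sub>v m"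
    and xs_carrier: "xs \<in> carrier_vec n" and ls_carrier: "ls \<in> carrier_vec m"
    and feasible: "A *\<^sub>v xs = 0\<^sub>v m" and stationary: "A\<^sup>T *\<^sub>v ls = g xs"
begin

lemma dims [simp]: "dim_row A = m" "dim_col A = n"
  using A_carrier by auto

lemma mult_A_carrier: "x \<in> carrier_vec n \<Longrightarrow> A *\<^sub>v x \<in> carrier_vec m"
  using A_carrier by auto

text \<open>Stationarity moves the linear term of the expansion at \<open>xs\<close> to the
  multiplier, and feasibility of \<open>xs\<close> removes its offset. No feasibility of
  \<open>x\<close> enters, so the identity serves infeasible iterates as well as optimality of
  \<open>xs\<close> and the absence of a duality gap.\<close>

lemma lagrangian_gap:
  assumes x: "x \<in> carrier_vec n"
  shows "f x - ls \<bullet> (A *\<^sub>v x) = f xs + Q (x - xs)"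
proof -
  have "g xs \<bullet> (x - xs) = ls \<bullet> (A *\<^sub>v (x - xs))"
    using transpose_vec_mult_scalar[OF A_carrier _ ls_carrier, of "x - xs"] x xs_carrier
    by (simp add: stationary)
  also have "A *\<^sub>v (x - xs) = A *\<^sub>v x - A *\<^sub>v xs"
    using mult_minus_distrib_mat_vec[OF A_carrier x xs_carrier] .
  also have "\<dots> = A *\<^sub>v x"
    using mult_A_carrier[OF x] by (simp add: feasible)
  finally show ?thesis using expand_diff[OF xs_carrier x] by simp
qed

lemma solution_iff:
  "is_solution f (indicator_zero m) A (0\<^sub>v m) y \<longleftrightarrow> y = xs"
proof -
  have sub0: "A *\<^sub>v x - 0\<^sub>v m = A *\<^sub>v x" if "x \<in> carrier_vec n" for x
    using mult_A_carrier[OF that] by simp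
  have sol: "is_solution f (indicator_zero m) A (0\<^sub>v m) y \<longleftrightarrow>
      y \<in> carrier_vec n \<and> A *\<^sub>v y = 0\<^sub>v m \<and>
      (\<forall>z\<in>carrier_vec n. A *\<^sub>v z = 0\<^sub>v m \<longrightarrow> f y \<le> f z)" for y
    unfolding is_solution_def by (auto simp: sub0 indicator_zero_def)
  have gap: "f x = f xs + Q (x - xs)" if "x \<in> carrier_vec n" "A *\<^sub>v x = 0\<^sub>v m" for x
    using lagrangian_gap[OF that(1)] ls_carrier by (simp add: that(2))
  show ?thesis
  proof
    assume "is_solution f (indicator_zero m) A (0\<^sub>v m) y"
    then have y: "y \<in> carrier_vec n" "A *\<^sub>v y = 0\<^sub>v m" "f y \<le> f xs"
      using xs_carrier feasible by (auto simp: sol)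
    then have yx: "y - xs \<in> carrier_vec n" and "Q (y - xs) \<le> 0" using gap[OF y(1,2)] xs_carrier by auto
    then have "mu / 2 * ((y - xs) \<bullet> (y - xs)) \<le> 0" using Q_lower[OF yx] by linarith
    then have "(y - xs) \<bullet> (y - xs) = 0"
      using mu_pos scalar_prod_self_nonneg[of "y - xs"] by (simp add: mult_le_0_iff)
    then have "y - xs = 0\<^sub>v n" using scalar_prod_self_eq_0[OF yx] by simp
    then show "y = xs" using y xs_carrier by (simp add: diff_vec_eq_0)
  next
    assume y: "y = xs"
    have "f xs \<le> f z" if "z \<in> carrier_vec n" "A *\<^sub>v z = 0\<^sub>v m" for z
      using gap[OF that] Q_nonneg[of "z - xs"] that(1) xs_carrier by simp
    then show "is_solution f (indicator_zero m) A (0\<^sub>v m) y"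
      using xs_carrier feasible by (simp add: sol y)
  qed
qed

lemma dual_fun_eq: "dual_fun f A (0\<^sub>v m) l = (INF x\<in>carrier_vec n. ereal (f x - l \<bullet> (A *\<^sub>v x)))"
  unfolding dual_fun_def using mult_A_carrier by (intro INF_cong) auto

lemma dual_fun_le: "l \<in> carrier_vec m \<Longrightarrow> dual_fun f A (0\<^sub>v m) l \<le> ereal (f xs)"
  unfolding dual_fun_eq by (rule INF_lower2[OF xs_carrier]) (simp add: feasible)

lemma dual_fun_ls: "dual_fun f A (0\<^sub>v m) ls = ereal (f xs)"
proof (rule antisym[OF dual_fun_le[OF ls_carrier]])
  show "ereal (f xs) \<le> dual_fun f A (0\<^sub>v m) ls"
    unfolding dual_fun_eq using lagrangian_gap Q_nonneg xs_carrier by (intro INF_greatest) simp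
qed

text \<open>Unless \<open>A\<^sup>T \<lambda> = \<nabla>f(x\<^sup>*)\<close>, one gradient step from \<open>x\<^sup>*\<close> on the Lagrangian lowers it
  strictly below \<open>f(x\<^sup>*)\<close>.\<close>

lemma dual_solution_iff: "is_dual_solution f A (0\<^sub>v m) l \<longleftrightarrow> l = ls"
proof
  assume "l = ls"
  then show "is_dual_solution f A (0\<^sub>v m) l"
    unfolding is_dual_solution_def using ls_carrier dual_fun_ls dual_fun_le by simp
next
  assume "is_dual_solution f A (0\<^sub>v m) l"
  then have l: "l \<in> carrier_vec m" and "ereal (f xs) \<le> dual_fun f A (0\<^sub>v m) l"
    using ls_carrier by (auto simp: is_dual_solution_def dual_fun_ls[symmetric])
  then have low: "f xs \<le> f x - l \<bullet> (A *\<^sub>v x)" if "x \<in> carrier_vec n" for x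
    using that by (auto simp: dual_fun_eq le_INF_iff)
  have Atl: "A\<^sup>T *\<^sub>v l \<in> carrier_vec n" using A_carrier l by auto
  define p where "p = g xs - A\<^sup>T *\<^sub>v l"
  define w where "w = (- 1 / L) \<cdot>\<^sub>v p"
  have p: "p \<in> carrier_vec n" and w: "w \<in> carrier_vec n"
    using xs_carrier Atl by (simp_all add: p_def w_def)
  have "A *\<^sub>v (xs + w) = A *\<^sub>v w"
    using mult_add_distrib_mat_vec[OF A_carrier xs_carrier w] mult_A_carrier[OF w]
    by (simp add: feasible)
  moreover have "l \<bullet> (A *\<^sub>v w) = (A\<^sup>T *\<^sub>v l) \<bullet> w"
    using transpose_vec_mult_scalar[OF A_carrier w l] by simp
  moreover have "g xs \<bullet> w - (A\<^sup>T *\<^sub>v l) \<bullet> w = p \<bullet> w"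
    unfolding p_def using xs_carrier Atl w by (subst minus_scalar_prod_distrib[of _ n]) auto
  ultimately have "0 \<le> p \<bullet> w + Q w"
    using low[of "xs + w"] expand[OF xs_carrier w] xs_carrier w by simp
  also have "\<dots> \<le> p \<bullet> w + L / 2 * (w \<bullet> w)" using Q_upper[OF w] by simp
  also have "\<dots> = - (p \<bullet> p) / (2 * L)"
    using p L_pos by (simp add: w_def field_simps power2_eq_square)
  finally have "p \<bullet> p \<le> 0" using L_pos by (simp add: field_simps)
  then have "p = 0\<^sub>v n" using scalar_prod_self_eq_0[OF p] scalar_prod_self_nonneg[of p] by simp
  then have eq: "A\<^sup>T *\<^sub>v l = A\<^sup>T *\<^sub>v ls"
    using xs_carrier Atl by (simp add: stationary p_def diff_vec_eq_0)
  have At: "A\<^sup>T \<in> carrier_mat n m" using A_carrier by simp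
  have "A\<^sup>T *\<^sub>v (l - ls) = 0\<^sub>v n"
    unfolding mult_minus_distrib_mat_vec[OF At l ls_carrier] eq
    using stationary xs_carrier by simp
  \<comment> \<open>Stationarity determines only \<open>A\<^sup>T *\<^sub>v l\<close>; full row rank
    of \<open>A\<close> turns this into uniqueness of the multiplier.\<close>
  then have "l - ls = 0\<^sub>v m" using transpose_inj[of "l - ls"] l ls_carrier by simp
  then show "l = ls" using l ls_carrier by (simp add: diff_vec_eq_0)
qed

end

section \<open>The condition number of the consensus matrix\<close>

lemma consensus_mat_carrier [simp]:
  "consensus_mat N d \<in> carrier_mat ((2 * N - 1) * d) (2 * N * d)"
  by (simp add: consensus_mat_def)

lemma consensus_mat_transpose_mult_carrier:
  "(consensus_mat N d)\<^sup>T *\<^sub>v y \<in> carrier_vec (2 * N * d)"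
  by (rule carrier_vecI) (simp add: consensus_mat_def)

lemma consensus_gram_mult:
  assumes "y \<in> carrier_vec ((2 * N - 1) * d)"
  shows "(consensus_mat N d * (consensus_mat N d)\<^sup>T) *\<^sub>v y
    = consensus_mat N d *\<^sub>v ((consensus_mat N d)\<^sup>T *\<^sub>v y)"
  using assoc_mult_mat_vec[OF consensus_mat_carrier
      iffD2[OF transpose_carrier_mat consensus_mat_carrier] assms] .

lemma block_rows_add: "1 \<le> N \<Longrightarrow> (2 * N - 1) * d + d = 2 * N * (d :: nat)"
  by (cases N) (auto simp: algebra_simps)

lemma consensus_mat_mult:
  assumes N: "1 \<le> N" and x: "x \<in> carrier_vec (2 * N * d)" and r: "r < (2 * N - 1) * d"
  shows "(consensus_mat N d *\<^sub>v x) $ r = x $ r - x $ (r + d)"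
proof -
  have d: "0 < d" using r by (cases d) auto
  have rd: "r + d < 2 * N * d" using r block_rows_add[OF N, of d] by linarith
  have "(consensus_mat N d *\<^sub>v x) $ r =
      (\<Sum>c\<in>{0..<2 * N * d}. (if c = r then x $ c else 0) - (if c = r + d then x $ c else 0))"
    using r x d by (auto simp: consensus_mat_def scalar_prod_def intro!: sum.cong)
  then show ?thesis using rd by (simp add: sum_subtractf)
qed

text \<open>The first block has no preceding constraint row and the last block no following one. The
  two conditionals fill these places with zeros, which are the Dirichlet ends of the path of
  constraint rows.\<close>

lemma consensus_mat_transpose_mult:
  assumes N: "1 \<le> N" and d: "0 < d" and y: "y \<in> carrier_vec ((2 * N - 1) * d)"
    and r: "r < 2 * N * d"
  shows "((consensus_mat N d)\<^sup>T *\<^sub>v y) $ r =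
    (if r < (2 * N - 1) * d then y $ r else 0) - (if d \<le> r then y $ (r - d) else 0)"
proof -
  let ?m = "(2 * N - 1) * d"
  have rd: "d \<le> r \<Longrightarrow> r - d < ?m" using r block_rows_add[OF N, of d] by linarith
  have "((consensus_mat N d)\<^sup>T *\<^sub>v y) $ r =
      (\<Sum>c\<in>{0..<?m}. (if c = r then y $ c else 0) - (if d \<le> r \<and> c = r - d then y $ c else 0))"
    using r y d by (auto simp: consensus_mat_def scalar_prod_def intro!: sum.cong)
  also have "\<dots> = (if r < ?m then y $ r else 0) - (if d \<le> r then y $ (r - d) else 0)"
    using rd by (cases "d \<le> r") (simp_all add: sum_subtractf)
  finally show ?thesis .
qed

lemma sum_shift:
  fixes F :: "nat \<Rightarrow> real"
  shows "(\<Sum>r<m + d. if d \<le> r then F r else 0) = (\<Sum>r<m. F (r + d))"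
proof -
  have "(\<Sum>r<m + d. if d \<le> r then F r else 0) = (\<Sum>r\<in>{d..<m + d}. F r)"
    by (intro sum.mono_neutral_cong_right) auto
  also have "\<dots> = (\<Sum>r\<in>{0..<m}. F (r + d))"
    using sum.shift_bounds_nat_ivl[of F 0 d m] by simp
  finally show ?thesis by (simp add: lessThan_atLeast0)
qed

lemma sum_truncate:
  fixes F :: "nat \<Rightarrow> real"
  shows "(\<Sum>r<m + d. if r < m then F r else 0) = (\<Sum>r<m. F r)"
  by (intro sum.mono_neutral_cong_right) auto

text \<open>The two sides differ by \<open>(p * a - q * b)\<^sup>2 / (p * q)\<close>. This is a
  discrete form of Picone's identity: a positive comparison profile yields a lower bound for a sum
  of squared differences.\<close>

lemma weighted_power2_diff_ge:
  fixes a b p q :: real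
  assumes "0 < p" "0 < q"
  shows "(1 - p / q) * a\<^sup>2 + (1 - q / p) * b\<^sup>2 \<le> (a - b)\<^sup>2"
proof -
  have "0 \<le> (p * a - q * b)\<^sup>2 / (p * q)" using assms by simp
  also have "\<dots> = (a - b)\<^sup>2 - ((1 - p / q) * a\<^sup>2 + (1 - q / p) * b\<^sup>2)"
    using assms by (simp add: field_simps power2_eq_square)
  finally show ?thesis by simp
qed

text \<open>The discrete Poincare inequality on the path with Dirichlet ends, by comparison with the
  concave profile \<open>s\<^sub>i = i (M - i)\<close>, whose second difference is \<open>-2\<close> and whose maximum is at most
  \<open>M\<^sup>2 / 4\<close>. Its constant is sharp for \<open>M = 2\<close>, which the bound on the condition number needs.\<close>

lemma discrete_poincare:
  fixes y :: "nat \<Rightarrow> real"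
  assumes M: "1 \<le> M" and d: "0 < d"
  defines "m \<equiv> (M - 1) * d"
  shows "8 / (real M)\<^sup>2 * (\<Sum>r<m. (y r)\<^sup>2)
    \<le> (\<Sum>r<m + d. ((if r < m then y r else 0) - (if d \<le> r then y (r - d) else 0))\<^sup>2)"
proof -
  define s where "s i = real i * (real M - real i)" for i
  define S where "S r = s (r div d + 1)" for r
  define S' where "S' r = s (r div d)" for r
  have md: "m + d = M * d" using M by (cases M) (auto simp: m_def)
  have div: "r div d + 1 < M" if "r < m" for r
  proof -
    have "r div d < M - 1" using that by (simp add: m_def less_mult_imp_div_less)
    then show ?thesis by simp
  qed
  have S_pos: "0 < S r" if "r < m" for r
    using div[OF that] by (simp add: S_def s_def)
  have S'_pos: "0 < S' r" if "r < m + d" "d \<le> r" for r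
  proof -
    have "r div d < M" using that(1) by (simp add: md less_mult_imp_div_less)
    moreover have "0 < r div d" using that(2) d by (simp add: div_greater_zero_iff)
    ultimately show ?thesis by (simp add: S'_def s_def)
  qed
  have S'_0: "S' r = 0" if "r < d" for r
    using that by (simp add: S'_def s_def)
  have S_0: "S r = 0" if "m \<le> r" "r < m + d" for r
  proof -
    have "r div d < M" using that(2) by (simp add: md less_mult_imp_div_less)
    moreover have "M - 1 \<le> r div d" using that(1) d by (simp add: m_def less_eq_div_iff_mult_less_eq)
    ultimately have "r div d + 1 = M" by simp
    then show ?thesis by (simp add: S_def s_def del: Suc_eq_plus1)
  qed
  \<comment> \<open>On an edge at an end of the path one neighbour is missing. The weight
    \<open>S' r\<close> or \<open>S r\<close> belonging to it is zero, so the coefficient of the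
    other neighbour is 1 and the estimate stays valid.\<close>
  have pt: "(if r < m then (1 - S' r / S r) * (y r)\<^sup>2 else 0)
        + (if d \<le> r then (1 - S r / S' r) * (y (r - d))\<^sup>2 else 0)
      \<le> ((if r < m then y r else 0) - (if d \<le> r then y (r - d) else 0))\<^sup>2"
    if r: "r < m + d" for r
    using weighted_power2_diff_ge[of "S' r" "S r" "y r" "y (r - d)"] S_pos[of r] S'_pos[OF r] S'_0[of r]
      S_0[OF _ r] by (cases "r < m"; cases "d \<le> r") auto
  \<comment> \<open>Each \<open>y r\<close> occurs on the edges \<open>r\<close> and
    \<open>r + d\<close>; its two coefficients add up to \<open>2 / S r\<close>.\<close>
  have "8 / (real M)\<^sup>2 * (\<Sum>r<m. (y r)\<^sup>2)
      \<le> (\<Sum>r<m. (1 - S' r / S r) * (y r)\<^sup>2 + (1 - S (r + d) / S' (r + d)) * (y r)\<^sup>2)"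
    unfolding sum_distrib_left
  proof (intro sum_mono)
    fix r assume "r \<in> {..<m}"
    then have r: "r < m" by simp
    define i where "i = real (r div d)"
    have Sr: "S r = (i + 1) * (real M - (i + 1))"
      by (simp add: S_def s_def i_def add.commute)
    have eq: "S' (r + d) = S r" "S (r + d) = (i + 2) * (real M - (i + 2))" "S' r = i * (real M - i)"
      using d by (simp_all add: S_def S'_def s_def i_def add.commute)
    have "0 \<le> (real M - 2 * (i + 1))\<^sup>2" by simp
    then have "4 * S r \<le> (real M)\<^sup>2" unfolding Sr by (simp add: power2_eq_square algebra_simps)
    then have "8 / (real M)\<^sup>2 \<le> 8 / (4 * S r)"
      using S_pos[OF r] M by (intro divide_left_mono) auto
    also have "\<dots> = 2 / S r" by simp
    also have "\<dots> = (1 - S' r / S r) + (1 - S (r + d) / S' (r + d))"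
    proof -
      have "2 * S r - S' r - S (r + d) = 2" unfolding eq Sr by (simp add: algebra_simps)
      then show ?thesis using S_pos[OF r] unfolding eq(1) by (simp add: field_simps)
    qed
    finally show "8 / (real M)\<^sup>2 * (y r)\<^sup>2
        \<le> (1 - S' r / S r) * (y r)\<^sup>2 + (1 - S (r + d) / S' (r + d)) * (y r)\<^sup>2"
      unfolding distrib_right[symmetric] by (intro mult_right_mono) auto
  qed
  also have "\<dots> = (\<Sum>r<m + d. (if r < m then (1 - S' r / S r) * (y r)\<^sup>2 else 0)
        + (if d \<le> r then (1 - S r / S' r) * (y (r - d))\<^sup>2 else 0))"
    unfolding sum.distrib sum_truncate sum_shift by simp
  also have "\<dots> \<le> (\<Sum>r<m + d. ((if r < m then y r else 0) - (if d \<le> r then y (r - d) else 0))\<^sup>2)"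
    using pt by (intro sum_mono) auto
  finally show ?thesis .
qed

text \<open>The path has \<open>2 * N - 1\<close> interior vertices, so
  \<open>discrete_poincare\<close> applies with \<open>M = 2 * N\<close>. The bound yields both
  injectivity of the transpose and the estimate of the smallest singular value.\<close>

lemma consensus_mat_transpose_lower:
  assumes N: "1 \<le> N" and d: "0 < d" and y: "y \<in> carrier_vec ((2 * N - 1) * d)"
  shows "2 / (real N)\<^sup>2 * (y \<bullet> y)
    \<le> ((consensus_mat N d)\<^sup>T *\<^sub>v y) \<bullet> ((consensus_mat N d)\<^sup>T *\<^sub>v y)"
proof -
  let ?m = "(2 * N - 1) * d" and ?z = "(consensus_mat N d)\<^sup>T *\<^sub>v y"
  have md: "?m + d = 2 * N * d" using block_rows_add[OF N] .
  have z: "?z \<in> carrier_vec (2 * N * d)"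
    by (rule consensus_mat_transpose_mult_carrier)
  have "8 / (real (2 * N))\<^sup>2 * (\<Sum>r<?m. (y $ r)\<^sup>2)
      \<le> (\<Sum>r<?m + d. ((if r < ?m then y $ r else 0) - (if d \<le> r then y $ (r - d) else 0))\<^sup>2)"
    using N d by (intro discrete_poincare) auto
  also have "\<dots> = (\<Sum>r<2 * N * d. (?z $ r)\<^sup>2)"
    unfolding md using N d y by (intro sum.cong refl) (simp add: consensus_mat_transpose_mult)
  finally show ?thesis
    using y z by (simp add: scalar_prod_lessThan power2_eq_square)
qed

lemma consensus_mat_transpose_inj:
  assumes N: "1 \<le> N" and d: "0 < d" and y: "y \<in> carrier_vec ((2 * N - 1) * d)"
    and z: "(consensus_mat N d)\<^sup>T *\<^sub>v y = 0\<^sub>v (2 * N * d)"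
  shows "y = 0\<^sub>v ((2 * N - 1) * d)"
proof -
  have "2 / (real N)\<^sup>2 * (y \<bullet> y) \<le> 0"
    using consensus_mat_transpose_lower[OF N d y] unfolding z by simp
  then have "y \<bullet> y \<le> 0" using N by (simp add: divide_le_0_iff mult_le_0_iff)
  then show ?thesis using scalar_prod_self_eq_0[OF y] scalar_prod_self_nonneg[of y] by simp
qed

lemma consensus_gram_eigenvalue_ge:
  assumes N: "1 \<le> N" and d: "0 < d"
    and e: "eigenvalue (consensus_mat N d * (consensus_mat N d)\<^sup>T) e"
  shows "2 / (real N)\<^sup>2 \<le> e"
proof -
  let ?A = "consensus_mat N d" and ?m = "(2 * N - 1) * d"
  obtain y where y: "y \<in> carrier_vec ?m" "y \<noteq> 0\<^sub>v ?m" and ev: "(?A * ?A\<^sup>T) *\<^sub>v y = e \<cdot>\<^sub>v y"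
    using e by (auto simp: eigenvalue_def eigenvector_def consensus_mat_def)
  have z: "?A\<^sup>T *\<^sub>v y \<in> carrier_vec (2 * N * d)"
    by (rule consensus_mat_transpose_mult_carrier)
  have "(?A\<^sup>T *\<^sub>v y) \<bullet> (?A\<^sup>T *\<^sub>v y) = y \<bullet> (?A *\<^sub>v (?A\<^sup>T *\<^sub>v y))"
    by (rule transpose_vec_mult_scalar[OF consensus_mat_carrier z y(1)])
  also have "?A *\<^sub>v (?A\<^sup>T *\<^sub>v y) = e \<cdot>\<^sub>v y"
    unfolding ev[symmetric] by (rule consensus_gram_mult[OF y(1), symmetric])
  also have "y \<bullet> (e \<cdot>\<^sub>v y) = e * (y \<bullet> y)" by simp
  finally have "2 / (real N)\<^sup>2 * (y \<bullet> y) \<le> e * (y \<bullet> y)"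
    using consensus_mat_transpose_lower[OF N d y(1)] by simp
  moreover have "0 < y \<bullet> y"
    using y scalar_prod_self_eq_0[OF y(1)] scalar_prod_self_nonneg[of y] by linarith
  ultimately show ?thesis by (simp only: mult_le_cancel_right_pos)
qed

text \<open>The path of block rows has an odd number of vertices, so \<open>(1, 0, -1, 0, \<dots>)\<close> is in the kernel
  of its adjacency matrix.\<close>

lemma consensus_gram_eigenvalue_2:
  assumes N: "1 \<le> N" and d: "0 < d"
  shows "eigenvalue (consensus_mat N d * (consensus_mat N d)\<^sup>T) 2"
proof -
  let ?A = "consensus_mat N d" and ?m = "(2 * N - 1) * d"
  \<comment> \<open>The sequence is 0, 1, 0, -1 with period four. It vanishes at all even indices,
    in particular at the ghost rows 0 and \<open>2 * N\<close>, so the formula for the differences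
    needs no exception at the ends.\<close>
  define h :: "nat \<Rightarrow> real" where "h i = (if even i then 0 else (-1) ^ (i div 2))" for i
  have h2: "h (Suc (Suc i)) = - h i" for i by (simp add: h_def)
  define y where "y = vec ?m (\<lambda>r. h (r div d + 1))"
  have y: "y \<in> carrier_vec ?m" by (simp add: y_def)
  have z: "?A\<^sup>T *\<^sub>v y \<in> carrier_vec (2 * N * d)"
    by (rule consensus_mat_transpose_mult_carrier)
  have Aty: "(?A\<^sup>T *\<^sub>v y) $ r = h (r div d + 1) - h (r div d)" if r: "r < 2 * N * d" for r
  proof -
    have "h (r div d + 1) = 0" if "\<not> r < ?m"
    proof -
      have "r div d < 2 * N" using r by (simp add: less_mult_imp_div_less)
      moreover have "2 * N - 1 \<le> r div d" using that d by (simp add: less_eq_div_iff_mult_less_eq)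
      ultimately have "r div d + 1 = 2 * N" by simp
      then show ?thesis by (simp add: h_def del: Suc_eq_plus1)
    qed
    moreover have "(r - d) div d + 1 = r div d" "r - d < ?m" if "d \<le> r"
      using that d r block_rows_add[OF N, of d] by (auto simp: le_div_geq)
    moreover have "h (r div d) = 0" if "\<not> d \<le> r" using that by (simp add: h_def)
    ultimately show ?thesis
      unfolding consensus_mat_transpose_mult[OF N d y r] by (auto simp: y_def simp del: Suc_eq_plus1)
  qed
  have "?A *\<^sub>v (?A\<^sup>T *\<^sub>v y) = 2 \<cdot>\<^sub>v y"
  proof (rule eq_vecI)
    fix r assume "r < dim_vec (2 \<cdot>\<^sub>v y)"
    then have r: "r < ?m" using y by simp
    then have "r + d < 2 * N * d" using block_rows_add[OF N, of d] by linarith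
    then have "(?A *\<^sub>v (?A\<^sup>T *\<^sub>v y)) $ r = 2 * h (r div d + 1)"
      unfolding consensus_mat_mult[OF N z r] using d by (simp add: Aty h2)
    then show "(?A *\<^sub>v (?A\<^sup>T *\<^sub>v y)) $ r = (2 \<cdot>\<^sub>v y) $ r" using r by (simp add: y_def)
  qed (use y in \<open>simp add: consensus_mat_def\<close>)
  then have ev: "(?A * ?A\<^sup>T) *\<^sub>v y = 2 \<cdot>\<^sub>v y"
    by (simp only: consensus_gram_mult[OF y])
  have "0 < ?m" using N d by simp
  then have "y $ 0 = 1" by (simp add: y_def h_def)
  then have "y \<noteq> 0\<^sub>v ?m" using \<open>0 < ?m\<close> by auto
  then show ?thesis
    using y ev by (auto simp: eigenvalue_def eigenvector_def consensus_mat_def)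
qed

lemma consensus_min_singular_value_ge:
  assumes N: "1 \<le> N" and d: "0 < d"
  shows "sqrt 2 / real N \<le> min_singular_value (consensus_mat N d)"
proof -
  let ?A = "consensus_mat N d" and ?m = "(2 * N - 1) * d"
  let ?G = "?A * ?A\<^sup>T"
  have sv: "singular_values ?A = sqrt ` {e. eigenvalue ?G e}"
    by (simp add: singular_values_def consensus_mat_def)
  have G: "?G \<in> carrier_mat ?m ?m" using mult_carrier_mat consensus_mat_carrier transpose_carrier_mat by blast
  have "char_poly ?G \<noteq> 0" using degree_monic_char_poly[OF G] by auto
  then have "finite {e. eigenvalue ?G e}"
    unfolding eigenvalue_root_char_poly[OF G] by (rule poly_roots_finite)
  \<comment> \<open>A bound on \<open>Min\<close> needs a nonempty set of eigenvalues; the explicit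
    eigenvalue 2 provides a member.\<close>
  moreover have "{e. eigenvalue ?G e} \<noteq> {}" using consensus_gram_eigenvalue_2[OF N d] by blast
  moreover have "sqrt 2 / real N \<le> sqrt e" if "eigenvalue ?G e" for e
  proof -
    have "sqrt (2 / (real N)\<^sup>2) \<le> sqrt e"
      using consensus_gram_eigenvalue_ge[OF N d that] by simp
    then show ?thesis by (simp add: real_sqrt_divide)
  qed
  ultimately show ?thesis
    unfolding min_singular_value_def sv by (intro Min.boundedI) auto
qed

section \<open>Operator norm and condition number\<close>

lemma mat_norm_le:
  assumes "0 \<le> B"
    and "\<And>v. v \<in> carrier_vec (dim_col A) \<Longrightarrow> (A *\<^sub>v v) \<bullet> (A *\<^sub>v v) \<le> B\<^sup>2 * (v \<bullet> v)"
  shows "mat_norm A \<le> B"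
  unfolding mat_norm_def
proof (intro cSUP_least)
  show "{v \<in> carrier_vec (dim_col A). vnorm v \<le> 1} \<noteq> {}"
    by (auto simp: vnorm_def intro!: exI[of _ "0\<^sub>v (dim_col A)"])
  fix v assume v: "v \<in> {v \<in> carrier_vec (dim_col A). vnorm v \<le> 1}"
  then have "vnorm (A *\<^sub>v v) \<le> B * vnorm v" using assms by (simp add: vnorm_le_iff)
  also have "\<dots> \<le> B * 1" using v assms(1) by (intro mult_left_mono) auto
  finally show "vnorm (A *\<^sub>v v) \<le> B" by simp
qed

text \<open>Besides the factor 2 for the square of a difference, each coordinate is counted once per
  block row that contains it: twice in general, only once if \<open>N = 1\<close>. The smaller bound
  for \<open>N = 1\<close> is essential, since the condition number must then be at most 1.\<close>

lemma consensus_mat_norm_le: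
  assumes N: "1 \<le> N"
  shows "mat_norm (consensus_mat N d) \<le> (if N = 1 then sqrt 2 else 2)"
proof (rule mat_norm_le)
  let ?A = "consensus_mat N d" and ?m = "(2 * N - 1) * d"
  fix v :: "real vec" assume "v \<in> carrier_vec (dim_col ?A)"
  then have v: "v \<in> carrier_vec (2 * N * d)" by (simp add: consensus_mat_def)
  have md: "?m + d = 2 * N * d" using block_rows_add[OF N] .
  have "(?A *\<^sub>v v) \<bullet> (?A *\<^sub>v v) = (\<Sum>r<?m. (v $ r - v $ (r + d))\<^sup>2)"
    using N v mult_mat_vec_carrier[OF consensus_mat_carrier v]
    by (simp add: scalar_prod_lessThan consensus_mat_mult power2_eq_square)
  also have "\<dots> \<le> (\<Sum>r<?m. 2 * (v $ r)\<^sup>2 + 2 * (v $ (r + d))\<^sup>2)"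
  proof (intro sum_mono)
    fix r
    have "0 \<le> (v $ r + v $ (r + d))\<^sup>2" by simp
    then show "(v $ r - v $ (r + d))\<^sup>2 \<le> 2 * (v $ r)\<^sup>2 + 2 * (v $ (r + d))\<^sup>2"
      by (simp add: power2_eq_square algebra_simps)
  qed
  also have "\<dots> = 2 * (\<Sum>r<2 * N * d. (if r < ?m then (v $ r)\<^sup>2 else 0) + (if d \<le> r then (v $ r)\<^sup>2 else 0))"
    unfolding md[symmetric] sum.distrib sum_truncate sum_shift by (simp add: sum_distrib_left)
  also have "\<dots> \<le> 2 * (\<Sum>r<2 * N * d. (if N = 1 then 1 else 2) * (v $ r)\<^sup>2)"
    by (intro mult_left_mono sum_mono) auto
  also have "\<dots> = (if N = 1 then sqrt 2 else 2)\<^sup>2 * (v \<bullet> v)"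
    using v by (simp add: scalar_prod_lessThan power2_eq_square sum_distrib_left)
  finally show "(?A *\<^sub>v v) \<bullet> (?A *\<^sub>v v) \<le> (if N = 1 then sqrt 2 else 2)\<^sup>2 * (v \<bullet> v)" .
qed simp

text \<open>The target \<open>2 * N - 1\<close> is what the choice of \<open>N\<close> as the
  integer part of \<open>(kappa + 1) / 2\<close> keeps below \<open>kappa\<close>. For
  \<open>N = 1\<close> the two bounds \<open>sqrt 2\<close> cancel exactly.\<close>

lemma cond_number_consensus_mat:
  assumes N: "1 \<le> N" and d: "0 < d"
  shows "cond_number (consensus_mat N d) \<le> ereal (2 * real N - 1)"
proof -
  define s where "s = min_singular_value (consensus_mat N d)"
  have s: "sqrt 2 / real N \<le> s" unfolding s_def by (rule consensus_min_singular_value_ge[OF N d])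
  moreover have "0 < sqrt 2 / real N" using N by simp
  ultimately have pos: "0 < s" by linarith
  have "mat_norm (consensus_mat N d) \<le> (if N = 1 then sqrt 2 else 2)"
    by (rule consensus_mat_norm_le[OF N])
  also have "\<dots> \<le> (2 * real N - 1) * (sqrt 2 / real N)"
  proof (cases "N = 1")
    case False
    \<comment> \<open>The quotient of the two bounds is \<open>sqrt 2 * N\<close>. The slope 3/2 is
      good enough, because \<open>3 / 2 * N\<close> is at most \<open>2 * N - 1\<close> from
      \<open>N = 2\<close> on.\<close>
    have "sqrt 2 \<le> 3 / 2" by (rule real_le_lsqrt) (auto simp: power2_eq_square)
    then have "sqrt 2 * real N \<le> 3 / 2 * real N" by (intro mult_right_mono) auto
    also have "\<dots> \<le> 2 * real N - 1" using N False by simp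
    finally have "sqrt 2 * (sqrt 2 * real N) \<le> sqrt 2 * (2 * real N - 1)"
      by (intro mult_left_mono) auto
    moreover have "sqrt 2 * (sqrt 2 * real N) = 2 * real N" by (simp flip: mult.assoc)
    ultimately have "2 \<le> sqrt 2 * (2 * real N - 1) / real N"
      using N by (subst le_divide_eq) auto
    then show ?thesis using False by (simp add: mult.commute)
  qed simp
  also have "\<dots> \<le> (2 * real N - 1) * s" using s N by (intro mult_left_mono) auto
  finally have "mat_norm (consensus_mat N d) / s \<le> 2 * real N - 1"
    using pos by (simp add: field_simps)
  then show ?thesis using pos by (simp add: cond_number_def s_def)
qed

section \<open>The hard instance\<close>

lemma sum_lessThan_add:
  fixes F :: "nat \<Rightarrow> real"
  shows "(\<Sum>r<a + b. F r) = (\<Sum>r<a. F r) + (\<Sum>r<b. F (a + r))"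
  by (induction b) auto

lemma sum_blocks:
  fixes F :: "nat \<Rightarrow> real"
  shows "(\<Sum>r<N * d. F r) = (\<Sum>b<N. \<Sum>j<d. F (b * d + j))"
proof -
  have "(\<Sum>r\<in>{b * d..<b * d + d}. F r) = (\<Sum>j<d. F (b * d + j))" for b
    using sum.shift_bounds_nat_ivl[of F 0 "b * d" d] by (simp add: lessThan_atLeast0 add.commute)
  then show ?thesis by (simp flip: sum.nat_group)
qed

lemma sum_lessThan_Suc_zero_ends:
  fixes F :: "nat \<Rightarrow> real"
  assumes "F 0 = 0" "F n = 0"
  shows "(\<Sum>r<n. F (Suc r)) = (\<Sum>r<n. F r)"
  using sum.lessThan_Suc_shift[of F n] assms by simp

lemma scalar_prod_self_halves:
  fixes w :: "real vec"
  assumes w: "w \<in> carrier_vec (2 * N * d)"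
  shows "w \<bullet> w = (\<Sum>r<N * d. (w $ r)\<^sup>2) + (\<Sum>r<N * d. (w $ (N * d + r))\<^sup>2)"
proof -
  have "2 * N * d = N * d + N * d" by simp
  then show ?thesis
    using scalar_prod_lessThan[OF w, of w] by (simp only: sum_lessThan_add power2_eq_square)
qed

text \<open>The entry \<open>u\<^sub>j\<close> of \<open>G(u, v)\<close> has flat index \<open>r < N d\<close>, and its partner \<open>v\<^sub>j\<^sub>-\<^sub>1\<close> then has flat index
  \<open>r + N d - 1\<close>; at the first coordinate of a block the partner is replaced by the constant
  \<open>\<alpha>\<close>, which is split off here.\<close>

definition link :: "nat \<Rightarrow> nat \<Rightarrow> real vec \<Rightarrow> nat \<Rightarrow> real" where
  "link N d x r = (if d dvd r then 0 else x $ (r + N * d - 1))"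

definition source :: "real \<Rightarrow> nat \<Rightarrow> nat \<Rightarrow> real" where
  "source alpha d r = (if d dvd r then alpha else 0)"

definition residual :: "real \<Rightarrow> nat \<Rightarrow> nat \<Rightarrow> real vec \<Rightarrow> nat \<Rightarrow> real" where
  "residual alpha N d x r = source alpha d r + (link N d x r - x $ r)"

definition obj_form :: "real \<Rightarrow> real \<Rightarrow> nat \<Rightarrow> nat \<Rightarrow> real vec \<Rightarrow> real" where
  "obj_form L mu N d w = (L - mu) / 4 * (\<Sum>r<N * d. (link N d w r - w $ r)\<^sup>2) + mu / 2 * (w \<bullet> w)"

text \<open>An entry \<open>r\<close> of the last \<open>N\<close> blocks is the partner of index
  \<open>Suc r - N * d\<close>. The last coordinate of such a block, where
  \<open>d dvd Suc r\<close>, is nobody's partner and feels only the \<open>mu\<close> term.\<close>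

definition obj_grad :: "real \<Rightarrow> real \<Rightarrow> real \<Rightarrow> nat \<Rightarrow> nat \<Rightarrow> real vec \<Rightarrow> real vec" where
  "obj_grad L mu alpha N d x = vec (2 * N * d) (\<lambda>r. mu * x $ r + (L - mu) / 2 *
     (if r < N * d then - residual alpha N d x r
      else if d dvd Suc r then 0 else residual alpha N d x (Suc r - N * d)))"

lemma consensus_obj_flat:
  assumes d: "0 < d" and x: "x \<in> carrier_vec (2 * N * d)"
  shows "consensus_obj L mu alpha N d x =
    (L - mu) / 4 * (\<Sum>r<N * d. (residual alpha N d x r)\<^sup>2) + mu / 2 * (x \<bullet> x)"
proof -
  have blk: "block d x (Suc b) $ j = x $ (b * d + j)" if "j < d" for b j
    using that by (simp add: block_def)
  have nrm: "(vnorm (block d x (Suc b)))\<^sup>2 = (\<Sum>j<d. (x $ (b * d + j))\<^sup>2)" for b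
    unfolding vnorm_power2
    by (simp add: scalar_prod_def block_def lessThan_atLeast0 power2_eq_square)
  have res: "(alpha - block d x (Suc b) $ 0)\<^sup>2
      + (\<Sum>i = 1..d - 1. (block d x (N + Suc b) $ (i - 1) - block d x (Suc b) $ i)\<^sup>2)
      = (\<Sum>j<d. (residual alpha N d x (b * d + j))\<^sup>2)" for b
  proof -
    have "(\<Sum>j<d. (residual alpha N d x (b * d + j))\<^sup>2)
        = (residual alpha N d x (b * d))\<^sup>2 + (\<Sum>j\<in>{1..d - 1}. (residual alpha N d x (b * d + j))\<^sup>2)"
    proof -
      have "{..<d} = insert 0 {1..d - 1}" using d by auto
      then show ?thesis by simp
    qed
    moreover have "residual alpha N d x (b * d) = alpha - block d x (Suc b) $ 0"
      using d by (simp add: residual_def source_def link_def blk)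
    moreover have "residual alpha N d x (b * d + i)
        = block d x (N + Suc b) $ (i - 1) - block d x (Suc b) $ i" if "i \<in> {1..d - 1}" for i
    proof -
      have i: "1 \<le> i" "i < d" using that by auto
      have "\<not> d dvd b * d + i"
        using i by (simp add: dvd_eq_mod_eq_0)
      moreover have "b * d + i + N * d - 1 = (N + b) * d + (i - 1)"
        using i by (simp add: algebra_simps)
      ultimately show ?thesis
        using i blk[of "i - 1" "N + b"] by (simp add: residual_def source_def link_def blk)
    qed
    ultimately show ?thesis by simp
  qed
  have idx: "(\<Sum>i = 1..N. F i) = (\<Sum>b<N. F (Suc b))" for F :: "nat \<Rightarrow> real"
    by (simp add: sum.atLeast1_atMost_eq)
  have "x \<bullet> x = (\<Sum>b<N. \<Sum>j<d. (x $ (b * d + j))\<^sup>2) + (\<Sum>b<N. \<Sum>j<d. (x $ ((N + b) * d + j))\<^sup>2)"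
    unfolding scalar_prod_self_halves[OF x] sum_blocks by (simp add: algebra_simps)
  then have xx: "x \<bullet> x = (\<Sum>b<N. (vnorm (block d x (Suc b)))\<^sup>2 + (vnorm (block d x (N + Suc b)))\<^sup>2)"
    using nrm by (simp add: sum.distrib)
  show ?thesis
    unfolding consensus_obj_def G_fun_def idx res xx sum_blocks
    by (simp only: sum.distrib flip: sum_distrib_left)
qed

section \<open>Second-order expansion of the objective\<close>

lemma link_add:
  assumes "x \<in> carrier_vec (2 * N * d)" "w \<in> carrier_vec (2 * N * d)" "r < N * d"
  shows "link N d (x + w) r = link N d x r + link N d w r"
  using assms by (auto simp: link_def)

lemma residual_add:
  assumes "x \<in> carrier_vec (2 * N * d)" "w \<in> carrier_vec (2 * N * d)" "r < N * d"
  shows "residual alpha N d (x + w) r = residual alpha N d x r + (link N d w r - w $ r)"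
  using assms by (auto simp: link_add residual_def)

text \<open>This is the adjoint of the shift from \<open>v\<close> to \<open>u\<close>. Summation
  can be moved by one index without boundary terms because \<open>link\<close> vanishes at all
  multiples of \<open>d\<close>, hence at 0 and \<open>N * d\<close>.\<close>

lemma sum_link:
  "(\<Sum>r<N * d. if d dvd Suc r then 0 else (F (Suc r) :: real) * w $ (N * d + r))
    = (\<Sum>r<N * d. F r * link N d w r)"
proof -
  have "(\<Sum>r<N * d. if d dvd Suc r then 0 else F (Suc r) * w $ (N * d + r))
      = (\<Sum>r<N * d. F (Suc r) * link N d w (Suc r))"
    by (intro sum.cong) (auto simp: link_def add.commute)
  then show ?thesis
    using sum_lessThan_Suc_zero_ends[of "\<lambda>r. F r * link N d w r" "N * d"] by (simp add: link_def)
qed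

text \<open>Each entry of the last \<open>N\<close> blocks is linked at most once, and the last
  coordinate of a block never, so linking is a contraction.\<close>

lemma sum_link_power2_le:
  assumes w: "w \<in> carrier_vec (2 * N * d)"
  shows "(\<Sum>r<N * d. (link N d w r)\<^sup>2) \<le> (\<Sum>r<N * d. (w $ (N * d + r))\<^sup>2)"
proof -
  have "(\<Sum>r<N * d. (link N d w r)\<^sup>2) = (\<Sum>r<N * d. (link N d w (Suc r))\<^sup>2)"
    using sum_lessThan_Suc_zero_ends[of "\<lambda>r. (link N d w r)\<^sup>2" "N * d"] by (simp add: link_def)
  also have "\<dots> \<le> (\<Sum>r<N * d. (w $ (N * d + r))\<^sup>2)"
    by (intro sum_mono) (auto simp: link_def add.commute)
  finally show ?thesis .
qed

lemma obj_grad_scalar_prod: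
  assumes w: "w \<in> carrier_vec (2 * N * d)"
  shows "obj_grad L mu alpha N d x \<bullet> w =
    mu * (x \<bullet> w) + (L - mu) / 2 * (\<Sum>r<N * d. residual alpha N d x r * (link N d w r - w $ r))"
proof -
  let ?R = "residual alpha N d x" and ?n = "N * d"
  have n: "2 * N * d = ?n + ?n" by simp
  have "obj_grad L mu alpha N d x \<bullet> w = (\<Sum>r<?n + ?n. mu * (x $ r * w $ r) + (L - mu) / 2 *
     ((if r < ?n then - ?R r else if d dvd Suc r then 0 else ?R (Suc r - ?n)) * w $ r))"
    using w unfolding scalar_prod_lessThan[OF w] n[symmetric]
    by (intro sum.cong) (auto simp: obj_grad_def algebra_simps)
  also have "\<dots> = mu * (x \<bullet> w) + (L - mu) / 2 * (\<Sum>r<?n + ?n.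
     (if r < ?n then - ?R r else if d dvd Suc r then 0 else ?R (Suc r - ?n)) * w $ r)"
    unfolding scalar_prod_lessThan[OF w] n by (simp add: sum.distrib sum_distrib_left)
  also have "(\<Sum>r<?n + ?n. (if r < ?n then - ?R r else if d dvd Suc r then 0 else ?R (Suc r - ?n)) * w $ r)
      = (\<Sum>r<?n. - ?R r * w $ r) + (\<Sum>r<?n. if d dvd Suc r then 0 else ?R (Suc r) * w $ (?n + r))"
  proof -
    have "d dvd Suc (?n + r) \<longleftrightarrow> d dvd Suc r" for r
      using dvd_add_right_iff[of d ?n "Suc r"] by simp
    then show ?thesis
      unfolding sum_lessThan_add by (intro arg_cong2[of _ _ _ _ "(+)"] sum.cong) auto
  qed
  also have "\<dots> = (\<Sum>r<?n. ?R r * (link N d w r - w $ r))"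
    unfolding sum_link by (simp add: sum.distrib[symmetric] algebra_simps)
  finally show ?thesis .
qed

lemma obj_expand:
  assumes d: "0 < d" and x: "x \<in> carrier_vec (2 * N * d)" and w: "w \<in> carrier_vec (2 * N * d)"
  shows "consensus_obj L mu alpha N d (x + w) =
    consensus_obj L mu alpha N d x + obj_grad L mu alpha N d x \<bullet> w + obj_form L mu N d w"
proof -
  let ?R = "residual alpha N d"
  define a where "a = (\<Sum>r<N * d. (?R x r)\<^sup>2)"
  define b where "b = (\<Sum>r<N * d. ?R x r * (link N d w r - w $ r))"
  define c where "c = (\<Sum>r<N * d. (link N d w r - w $ r)\<^sup>2)"
  have xw: "x + w \<in> carrier_vec (2 * N * d)" using x w by simp
  have "(\<Sum>r<N * d. (?R (x + w) r)\<^sup>2) =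
      (\<Sum>r<N * d. (?R x r)\<^sup>2 + 2 * (?R x r * (link N d w r - w $ r)) + (link N d w r - w $ r)\<^sup>2)"
    using x w by (intro sum.cong) (auto simp: residual_add power2_eq_square algebra_simps)
  also have "\<dots> = a + 2 * b + c"
    by (simp add: a_def b_def c_def sum.distrib sum_distrib_left)
  finally have "(\<Sum>r<N * d. (?R (x + w) r)\<^sup>2) = a + 2 * b + c" .
  moreover have "(x + w) \<bullet> (x + w) = x \<bullet> x + 2 * (x \<bullet> w) + w \<bullet> w"
    using x w by (simp add: add_scalar_prod_distrib[of _ "2 * N * d"]
        scalar_prod_add_distrib[of _ "2 * N * d"] comm_scalar_prod[OF w x])
  ultimately show ?thesis
    unfolding consensus_obj_flat[OF d x] consensus_obj_flat[OF d xw] obj_grad_scalar_prod[OF w]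
      obj_form_def a_def[symmetric] b_def[symmetric] c_def[symmetric] by (simp add: field_simps)
qed

text \<open>The squared differences cost at most \<open>2 * (w \<bullet> w)\<close>. Together with
  the weight \<open>(L - mu) / 4\<close> and the \<open>mu\<close> term this adds up to exactly
  \<open>L / 2\<close>, which explains the weight in \<open>G_fun\<close>.\<close>

lemma obj_form_upper:
  assumes w: "w \<in> carrier_vec (2 * N * d)" and mu: "mu \<le> L"
  shows "obj_form L mu N d w \<le> L / 2 * (w \<bullet> w)"
proof -
  have "(\<Sum>r<N * d. (link N d w r - w $ r)\<^sup>2) \<le> (\<Sum>r<N * d. 2 * (link N d w r)\<^sup>2 + 2 * (w $ r)\<^sup>2)"
  proof (intro sum_mono)
    fix r
    have "0 \<le> (link N d w r + w $ r)\<^sup>2" by simp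
    then show "(link N d w r - w $ r)\<^sup>2 \<le> 2 * (link N d w r)\<^sup>2 + 2 * (w $ r)\<^sup>2"
      by (simp add: power2_eq_square algebra_simps)
  qed
  also have "\<dots> \<le> 2 * ((\<Sum>r<N * d. (w $ r)\<^sup>2) + (\<Sum>r<N * d. (w $ (N * d + r))\<^sup>2))"
    using sum_link_power2_le[OF w] by (simp add: sum.distrib flip: sum_distrib_left)
  also have "\<dots> = 2 * (w \<bullet> w)"
    by (simp add: scalar_prod_self_halves[OF w])
  finally have "(L - mu) / 4 * (\<Sum>r<N * d. (link N d w r - w $ r)\<^sup>2) \<le> (L - mu) / 4 * (2 * (w \<bullet> w))"
    using mu by (intro mult_left_mono) auto
  then show ?thesis by (simp add: obj_form_def field_simps)
qed

lemma quadratic_objective_consensus: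
  assumes "0 < d" "0 < mu" "mu \<le> L"
  shows "quadratic_objective (2 * N * d) (consensus_obj L mu alpha N d) (obj_grad L mu alpha N d)
    (obj_form L mu N d) L mu"
proof
  show "mu / 2 * (w \<bullet> w) \<le> obj_form L mu N d w" for w
    unfolding obj_form_def using assms by (simp add: sum_nonneg)
qed (use assms obj_expand obj_form_upper in \<open>auto simp: obj_grad_def\<close>)

section \<open>Solution and multiplier of the consensus problem\<close>

text \<open>On the consensus subspace the stationarity condition is the three-term recurrence for the common
  block, extended to the ghost indices \<open>0\<close> and \<open>d + 1\<close>: the former carries \<open>\<alpha>\<close>, the latter the
  free end. The multiplier accumulates the block gradients, which are \<open>\<gamma>\<close> in the first \<open>N\<close>
  blocks and \<open>-\<gamma>\<close> in the others.\<close>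

definition consensus_vec :: "nat \<Rightarrow> nat \<Rightarrow> (nat \<Rightarrow> real) \<Rightarrow> real vec" where
  "consensus_vec N d V = vec (2 * N * d) (\<lambda>r. V (r mod d + 1))"

definition block_grad :: "real \<Rightarrow> real \<Rightarrow> (nat \<Rightarrow> real) \<Rightarrow> nat \<Rightarrow> real" where
  "block_grad L mu V j = mu * V (j + 1) - (L - mu) / 2 * (V j - V (j + 1))"

definition multiplier :: "real \<Rightarrow> real \<Rightarrow> nat \<Rightarrow> nat \<Rightarrow> (nat \<Rightarrow> real) \<Rightarrow> real vec" where
  "multiplier L mu N d V = vec ((2 * N - 1) * d)
     (\<lambda>r. real (min (r div d + 1) (2 * N - (r div d + 1))) * block_grad L mu V (r mod d))"

text \<open>The recurrence says that the gradient entries of a coordinate in a \<open>u\<close>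
  block and in a \<open>v\<close> block sum to zero, whence the opposite signs. At the last
  coordinate of a \<open>v\<close> block the missing link agrees with
  \<open>V d - V (d + 1) = 0\<close>.\<close>

lemma obj_grad_consensus_vec:
  assumes d: "0 < d"
    and rec: "\<And>j. j < d \<Longrightarrow>
      2 * mu * V (j + 1) + (L - mu) / 2 * (2 * V (j + 1) - V j - V (j + 2)) = 0"
    and free_end: "V d = V (d + 1)"
    and r: "r < 2 * N * d"
  shows "obj_grad L mu (V 0) N d (consensus_vec N d V) $ r =
    (if r < N * d then 1 else -1) * block_grad L mu V (r mod d)"
proof -
  let ?x = "consensus_vec N d V"
  have res: "residual (V 0) N d ?x r = V (r mod d) - V (r mod d + 1)" if r: "r < N * d" for r
  proof (cases "d dvd r")
    case True
    then show ?thesis using r d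
      by (auto simp: residual_def source_def link_def consensus_vec_def dvd_eq_mod_eq_0)
  next
    case False
    then have "r mod d \<noteq> 0" by (simp add: dvd_eq_mod_eq_0)
    then obtain j where j: "r mod d = Suc j" by (cases "r mod d") auto
    have "r + N * d - 1 = (r div d + N) * d + j"
      using div_mult_mod_eq[of r d] j by (simp add: algebra_simps)
    moreover have "j < d" using j d by (metis Suc_lessD mod_less_divisor)
    ultimately have "(r + N * d - 1) mod d = j" by simp
    then show ?thesis using r False
      by (simp add: residual_def source_def link_def consensus_vec_def j)
  qed
  show ?thesis
  proof (cases "r < N * d")
    case True
    then show ?thesis using r res[OF True]
      by (simp add: obj_grad_def block_grad_def) (simp add: consensus_vec_def field_simps)
  next
    case False
    define j where "j = r mod d"
    have j: "j < d" using d by (simp add: j_def)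
    have "(if d dvd Suc r then 0 else residual (V 0) N d ?x (Suc r - N * d)) = V (j + 1) - V (j + 2)"
    proof (cases "d dvd Suc r")
      case True
      then have "j + 1 = d"
        using j by (simp add: j_def dvd_eq_mod_eq_0 mod_Suc split: if_splits)
      then show ?thesis using True free_end by auto
    next
      case False2: False
      then have "Suc r mod d = j + 1"
        by (auto simp: j_def dvd_eq_mod_eq_0 mod_Suc split: if_splits)
      then have m: "(Suc r - N * d) mod d = j + 1"
        using False by (metis Suc_diff_le le_add_diff_inverse less_Suc_eq_le mod_mult_self2 mult.commute
            add.commute not_less Suc_leD le_SucI)
      have "Suc r \<noteq> N * d + N * d" using False2 by auto
      then have "Suc r - N * d < N * d" using r by auto
      then show ?thesis using False2 res m by simp
    qed
    then have "obj_grad L mu (V 0) N d ?x $ r = mu * V (j + 1) + (L - mu) / 2 * (V (j + 1) - V (j + 2))"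
      using r False by (simp add: obj_grad_def) (simp add: consensus_vec_def j_def)
    then show ?thesis
      using False rec[OF j] by (simp add: block_grad_def j_def[symmetric] field_simps)
  qed
qed

text \<open>The weights form a tent along the path: zero at both ghost ends, rising by one per block
  up to \<open>N\<close> and falling by one afterwards. Their differences are the required
  signs.\<close>

lemma transpose_mult_multiplier:
  assumes N: "1 \<le> N" and d: "0 < d" and r: "r < 2 * N * d"
  shows "((consensus_mat N d)\<^sup>T *\<^sub>v multiplier L mu N d V) $ r =
    (if r < N * d then 1 else -1) * block_grad L mu V (r mod d)"
proof -
  let ?m = "(2 * N - 1) * d" and ?l = "multiplier L mu N d V"
  define b where "b = r div d"
  define g where "g = block_grad L mu V (r mod d)"
  have l: "?l \<in> carrier_vec ?m" by (simp add: multiplier_def)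
  have b: "b < 2 * N" using r by (simp add: b_def less_mult_imp_div_less)
  have "(if r < ?m then ?l $ r else 0) = real (min (b + 1) (2 * N - (b + 1))) * g"
  proof (cases "r < ?m")
    case True
    then show ?thesis by (simp add: multiplier_def b_def g_def)
  next
    case False
    then have "2 * N - 1 \<le> b" using d by (simp add: b_def less_eq_div_iff_mult_less_eq)
    \<comment> \<open>In the last block the tent has returned to zero, which matches the absent
      constraint row.\<close>
    then have "2 * N - (b + 1) = 0" by simp
    then show ?thesis using False by (simp del: diff_is_0_eq diff_is_0_eq')
  qed
  moreover have "(if d \<le> r then ?l $ (r - d) else 0) = real (min b (2 * N - b)) * g"
  proof (cases "d \<le> r")
    case True
    then have "(r - d) div d + 1 = b" "(r - d) mod d = r mod d" "r - d < ?m"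
      using r d block_rows_add[OF N, of d] by (auto simp: b_def le_div_geq le_mod_geq)
    then show ?thesis using True by (simp add: multiplier_def g_def del: Suc_eq_plus1)
  qed (simp add: b_def)
  moreover have "r < N * d \<longleftrightarrow> b < N"
    using d by (simp add: b_def div_less_iff_less_mult)
  moreover have "real (min (b + 1) (2 * N - (b + 1))) - real (min b (2 * N - b)) = (if b < N then 1 else -1)"
    using b by (auto simp: min_def of_nat_diff)
  ultimately show ?thesis
    unfolding consensus_mat_transpose_mult[OF N d l r] g_def[symmetric]
    by (simp only: left_diff_distrib[symmetric])
qed

lemma constrained_quadratic_consensus:
  assumes N: "1 \<le> N" and d: "0 < d" and mu: "0 < mu" "mu \<le> L"
    and rec: "\<And>j. j < d \<Longrightarrow>
      2 * mu * V (j + 1) + (L - mu) / 2 * (2 * V (j + 1) - V j - V (j + 2)) = 0"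
    and free_end: "V d = V (d + 1)"
  shows "constrained_quadratic (2 * N * d) (consensus_obj L mu (V 0) N d) (obj_grad L mu (V 0) N d)
    (obj_form L mu N d) L mu ((2 * N - 1) * d) (consensus_mat N d)
    (consensus_vec N d V) (multiplier L mu N d V)"
proof -
  let ?x = "consensus_vec N d V"
  interpret quadratic_objective "2 * N * d" "consensus_obj L mu (V 0) N d" "obj_grad L mu (V 0) N d"
      "obj_form L mu N d" L mu
    using quadratic_objective_consensus[OF d mu] .
  have x: "?x \<in> carrier_vec (2 * N * d)" by (simp add: consensus_vec_def)
  show ?thesis
  proof
    show "consensus_mat N d *\<^sub>v ?x = 0\<^sub>v ((2 * N - 1) * d)"
    proof (rule eq_vecI)
      fix r assume "r < dim_vec (0\<^sub>v ((2 * N - 1) * d) :: real vec)"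
      then have r: "r < (2 * N - 1) * d" by simp
      then have "r + d < 2 * N * d" using block_rows_add[OF N, of d] by linarith
      then show "(consensus_mat N d *\<^sub>v ?x) $ r = 0\<^sub>v ((2 * N - 1) * d) $ r"
        unfolding consensus_mat_mult[OF N x r] using r by (simp add: consensus_vec_def)
    qed (simp add: consensus_mat_def)
    show "(consensus_mat N d)\<^sup>T *\<^sub>v multiplier L mu N d V = obj_grad L mu (V 0) N d ?x"
    proof (rule eq_vecI)
      fix r assume "r < dim_vec (obj_grad L mu (V 0) N d ?x)"
      then have r: "r < 2 * N * d" by (simp add: obj_grad_def)
      show "((consensus_mat N d)\<^sup>T *\<^sub>v multiplier L mu N d V) $ r = obj_grad L mu (V 0) N d ?x $ r"
        using transpose_mult_multiplier[OF N d r] obj_grad_consensus_vec[OF d rec free_end r] by simp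
    qed (simp add: consensus_mat_def obj_grad_def)
  qed (use x consensus_mat_transpose_inj[OF N d] consensus_mat_carrier in \<open>auto simp: multiplier_def\<close>)
qed

section \<open>Propagation of nonzero entries\<close>

text \<open>Each iteration carries information to a neighbouring block, or from
  \<open>v\<^sub>j\<^sub>-\<^sub>1\<close> to \<open>u\<^sub>j\<close> across \<open>N\<close> blocks, so advancing by one coordinate costs \<open>N + 1\<close> iterations.\<close>

definition reached :: "nat \<Rightarrow> nat \<Rightarrow> nat \<Rightarrow> real vec set" where
  "reached N d k = {y \<in> carrier_vec (2 * N * d).
     \<forall>r<2 * N * d. k + N < (r mod d) * (N + 1) + r div d + 2 \<longrightarrow> y $ r = 0}"

lemma reached_mono: "i \<le> k \<Longrightarrow> reached N d i \<subseteq> reached N d k"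
  by (auto simp: reached_def)

lemma vspan_subset_reached:
  assumes "S \<subseteq> reached N d k"
  shows "vspan (2 * N * d) S \<subseteq> reached N d k"
proof -
  let ?M = "module_vec TYPE(real) (2 * N * d)"
  interpret vec_module "TYPE(real)" "2 * N * d" .
  have "submodule class_ring (reached N d k) ?M"
    by (rule submodule.intro, rule module_axioms) (auto simp: reached_def module_vec_def)
  then show ?thesis using assms by (intro span_is_subset) auto
qed

lemma obj_grad_reached:
  assumes d: "0 < d" and y: "y \<in> reached N d k"
  shows "obj_grad L mu alpha N d y \<in> reached N d (Suc k)"
  unfolding reached_def
proof (intro CollectI conjI allI impI)
  have y0: "y $ r = 0" if "r < 2 * N * d" "k + N < (r mod d) * (N + 1) + r div d + 2" for r
    using y that by (auto simp: reached_def)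
  have res: "residual alpha N d y r = 0"
    if r: "r < N * d" and late: "Suc k + N < (r mod d) * (N + 1) + r div d + 2" for r
  proof -
    have "r div d < N" using r by (simp add: less_mult_imp_div_less)
    have "r mod d \<noteq> 0"
    proof
      assume "r mod d = 0"
      then have "Suc k + N < r div d + 2" using late by simp
      then show False using \<open>r div d < N\<close> by linarith
    qed
    then obtain j where j: "r mod d = Suc j" by (cases "r mod d") auto
    have nd: "\<not> d dvd r" by (simp add: dvd_eq_mod_eq_0 j)
    have eq: "r + N * d - 1 = (r div d + N) * d + j"
      using div_mult_mod_eq[of r d] j by (simp add: algebra_simps)
    have "j < d" using j d by (metis Suc_lessD mod_less_divisor)
    then have "(r + N * d - 1) mod d = j" "(r + N * d - 1) div d = r div d + N"
      unfolding eq by simp_all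
    then have "y $ (r + N * d - 1) = 0" using r late j by (intro y0) auto
    moreover have "y $ r = 0" using r late by (intro y0) auto
    ultimately show ?thesis using nd by (simp add: residual_def source_def link_def)
  qed
  fix r assume r: "r < 2 * N * d" and late: "Suc k + N < (r mod d) * (N + 1) + r div d + 2"
  have yr: "y $ r = 0" using r late by (intro y0) auto
  show "obj_grad L mu alpha N d y $ r = 0"
  proof (cases "r < N * d \<or> d dvd Suc r")
    case True
    then show ?thesis using r res[OF _ late] yr by (auto simp: obj_grad_def)
  next
    case False
    then have N_le: "N * d \<le> r" and nd: "\<not> d dvd Suc r" by auto
    define s where "s = r - N * d"
    have rs: "r = s + N * d" using N_le by (simp add: s_def)
    have nds: "Suc s mod d \<noteq> 0" using nd by (simp add: rs dvd_eq_mod_eq_0 flip: add_Suc)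
    then have md: "Suc s mod d = Suc (s mod d)" "Suc s div d = s div d"
      by (auto simp: mod_Suc div_Suc split: if_splits)
    have "Suc s \<noteq> N * d" using nds by auto
    then have s: "Suc s < N * d" using r by (simp add: rs)
    have "Suc k + N < (Suc s mod d) * (N + 1) + Suc s div d + 2"
      using late d by (simp add: rs md)
    then have "residual alpha N d y (Suc s) = 0" by (rule res[OF s])
    moreover have "Suc r - N * d = Suc s" by (simp add: rs)
    ultimately show ?thesis using r False yr by (simp add: obj_grad_def)
  qed
qed (simp add: obj_grad_def)

text \<open>The normal matrix is the Laplacian of the path of blocks: entry \<open>r\<close> depends
  only on the entries \<open>r\<close>, \<open>r + d\<close> and \<open>r - d\<close>, whose levels
  differ by at most 1.\<close>

lemma consensus_normal_reached:
  assumes N: "1 \<le> N" and d: "0 < d" and y: "y \<in> reached N d k"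
  shows "(consensus_mat N d)\<^sup>T *\<^sub>v (consensus_mat N d *\<^sub>v y) \<in> reached N d (Suc k)"
  unfolding reached_def
proof (intro CollectI conjI allI impI)
  let ?A = "consensus_mat N d" and ?m = "(2 * N - 1) * d"
  have yc: "y \<in> carrier_vec (2 * N * d)" using y by (simp add: reached_def)
  have y0: "y $ r = 0" if "r < 2 * N * d" "k + N < (r mod d) * (N + 1) + r div d + 2" for r
    using y that by (auto simp: reached_def)
  have Ay: "?A *\<^sub>v y \<in> carrier_vec ?m" using mult_mat_vec_carrier[OF consensus_mat_carrier yc] .
  fix r assume r: "r < 2 * N * d" and late: "Suc k + N < (r mod d) * (N + 1) + r div d + 2"
  have yr: "y $ r = 0" using r late by (intro y0) auto
  have "(?A *\<^sub>v y) $ r = 0" if m: "r < ?m"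
  proof -
    have "r + d < 2 * N * d" using m block_rows_add[OF N, of d] by linarith
    then have "y $ (r + d) = 0" using late d by (intro y0) auto
    then show ?thesis unfolding consensus_mat_mult[OF N yc m] using yr by simp
  qed
  moreover have "(?A *\<^sub>v y) $ (r - d) = 0" if dr: "d \<le> r"
  proof -
    have m: "r - d < ?m" using dr r block_rows_add[OF N, of d] by linarith
    have "y $ (r - d) = 0"
      using r late dr d by (intro y0) (auto simp: le_mod_geq le_div_geq)
    then show ?thesis unfolding consensus_mat_mult[OF N yc m] using yr dr by simp
  qed
  ultimately show "(?A\<^sup>T *\<^sub>v (?A *\<^sub>v y)) $ r = 0"
    unfolding consensus_mat_transpose_mult[OF N d Ay r] by simp
qed (rule consensus_mat_transpose_mult_carrier)

lemma iterates_reached: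
  assumes N: "1 \<le> N" and d: "0 < d"
    and grad: "\<And>y. y \<in> carrier_vec (2 * N * d) \<Longrightarrow> grad (2 * N * d) f y = obj_grad L mu alpha N d y"
    and iter: "linear_span_iterates f (consensus_mat N d) (0\<^sub>v ((2 * N - 1) * d)) x"
  shows "x k \<in> reached N d k"
proof -
  let ?A = "consensus_mat N d" and ?b = "0\<^sub>v ((2 * N - 1) * d) :: real vec"
  have x: "x 0 = 0\<^sub>v (2 * N * d)" "x i \<in> span_sets f ?A ?b x i" for i
    using iter by (auto simp: linear_span_iterates_def consensus_mat_def)
  have dim: "dim_col ?A = 2 * N * d" by (simp add: consensus_mat_def)
  have "span_sets f ?A ?b x k \<subseteq> reached N d k" for k
  proof (induction k rule: less_induct)
    case (less k)
    show ?case
    proof (cases k)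
      case 0
      then show ?thesis using x(1)
        by (simp add: dim) (rule vspan_subset_reached, simp add: reached_def)
    next
      case (Suc l)
      have sub: "span_sets f ?A ?b x i \<subseteq> reached N d i" if "i \<le> l" for i
        using less.IH[of i] that Suc by simp
      have mono: "reached N d i \<subseteq> reached N d k" "reached N d (Suc i) \<subseteq> reached N d k" if "i \<le> l" for i
        using that Suc by (simp_all add: reached_mono)
      have minus0: "?A *\<^sub>v y - ?b = ?A *\<^sub>v y" if "y \<in> carrier_vec (2 * N * d)" for y
        using mult_mat_vec_carrier[OF consensus_mat_carrier that] by simp
      have "x i \<in> reached N d k" if "i \<le> l" for i
        using x(2)[of i] sub[OF that] mono[OF that] by blast
      moreover have "grad (2 * N * d) f y \<in> reached N d k"
          "?A\<^sup>T *\<^sub>v (?A *\<^sub>v y - ?b) \<in> reached N d k"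
        if "i \<le> l" "y \<in> span_sets f ?A ?b x i" for i y
      proof -
        have y: "y \<in> reached N d i" using sub that by blast
        then have yc: "y \<in> carrier_vec (2 * N * d)" by (simp add: reached_def)
        show "grad (2 * N * d) f y \<in> reached N d k"
          using obj_grad_reached[OF d y] mono[OF that(1)] by (auto simp: grad[OF yc])
        show "?A\<^sup>T *\<^sub>v (?A *\<^sub>v y - ?b) \<in> reached N d k"
          using consensus_normal_reached[OF N d y] mono[OF that(1)] unfolding minus0[OF yc] by blast
      qed
      ultimately show ?thesis
        unfolding Suc span_sets.simps dim
        by (intro vspan_subset_reached) (auto simp: Suc)
    qed
  qed
  then show ?thesis using x(2) by blast
qed

section \<open>Distance of reached vectors from the solution\<close>

lemma sum_periodic:
  fixes F :: "nat \<Rightarrow> real"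
  shows "(\<Sum>r<M * d. F (r mod d)) = real M * (\<Sum>j<d. F j)"
  unfolding sum_blocks by simp

text \<open>In a block of index at least \<open>N\<close> and from coordinate \<open>K\<close> on,
  the hypothesis on \<open>k\<close> makes the iterate vanish, so the difference retains the full
  entry of the solution. The first \<open>N\<close> blocks are discarded, since coordinate
  \<open>K\<close> may already be reached there.\<close>

lemma obj_form_reached_ge:
  assumes d: "d = 2 * K" and K: "1 \<le> K" and k: "k < K * (N + 1) + 2" and mu: "0 < mu" "mu \<le> L"
    and x: "x \<in> reached N d k"
  shows "mu / 2 * (real N * (\<Sum>j<K. (V (K + j + 1))\<^sup>2)) \<le> obj_form L mu N d (x - consensus_vec N d V)"
proof -
  let ?n = "N * d" and ?w = "x - consensus_vec N d V"
  have xc: "x \<in> carrier_vec (2 * N * d)" using x by (simp add: reached_def)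
  have w: "?w \<in> carrier_vec (2 * N * d)" using xc by (simp add: consensus_vec_def)
  define F where "F j = (if j < K then 0 else (V (j + 1))\<^sup>2)" for j
  have "real N * (\<Sum>j<K. (V (K + j + 1))\<^sup>2) = (\<Sum>r<?n. F (r mod d))"
  proof -
    have "(\<Sum>j<d. F j) = (\<Sum>j<K. (V (K + j + 1))\<^sup>2)"
      unfolding d mult_2 sum_lessThan_add by (simp add: F_def)
    then show ?thesis unfolding sum_periodic by simp
  qed
  also have "\<dots> \<le> (\<Sum>r<?n. (?w $ (?n + r))\<^sup>2)"
  proof (intro sum_mono)
    fix r assume "r \<in> {..<?n}"
    then have r: "?n + r < 2 * N * d" by simp
    show "F (r mod d) \<le> (?w $ (?n + r))\<^sup>2"
    proof (cases "r mod d < K")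
      case False
      have dpos: "0 < d" using d K by simp
      have "K * (N + 1) \<le> (r mod d) * (N + 1)" using False by (intro mult_le_mono1) simp
      then have "k + N < ((?n + r) mod d) * (N + 1) + (?n + r) div d + 2"
        using k dpos by simp
      then have "x $ (?n + r) = 0" using x r by (auto simp: reached_def)
      then show ?thesis using r False xc by (simp add: F_def consensus_vec_def)
    qed (simp add: F_def)
  qed
  also have "\<dots> \<le> (\<Sum>r<?n. (?w $ r)\<^sup>2) + (\<Sum>r<?n. (?w $ (?n + r))\<^sup>2)"
    by (simp add: sum_nonneg)
  also have "\<dots> = ?w \<bullet> ?w"
    by (simp add: scalar_prod_self_halves[OF w])
  finally have "mu / 2 * (real N * (\<Sum>j<K. (V (K + j + 1))\<^sup>2)) \<le> mu / 2 * (?w \<bullet> ?w)"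
    using mu by (intro mult_left_mono) auto
  also have "\<dots> \<le> obj_form L mu N d ?w"
    unfolding obj_form_def using mu by (simp add: sum_nonneg)
  finally show ?thesis .
qed

section \<open>Explicit solution of the recurrence and its decay\<close>

text \<open>The common block of the solution, up to scaling: the solution of the recurrence that is
  symmetric about the free end \<open>d + 1/2\<close>.\<close>

definition profile :: "real \<Rightarrow> nat \<Rightarrow> nat \<Rightarrow> real" where
  "profile q d j = q ^ j + q ^ (2 * d + 1 - j)"

lemma profile_pos: "0 < q \<Longrightarrow> 0 < profile q d j"
  by (simp add: profile_def add_pos_pos)

lemma profile_free_end: "profile q d d = profile q d (d + 1)"
  by (simp add: profile_def)

text \<open>Since \<open>L / mu\<close> is the square of \<open>K + 1\<close>, \<open>L - mu\<close>
  equals \<open>mu * K * (K + 2)\<close>, and the characteristic equation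
  \<open>4 * q = K * (K + 2) * (1 - q)\<^sup>2\<close> has the rational root
  \<open>K / (K + 2)\<close>. It is invariant under reversal of the index, so the reflected power is
  a solution too.\<close>

lemma profile_recurrence:
  fixes K d j :: nat and mu L :: real
  assumes K: "1 \<le> K" and mu: "mu = L / (real K + 1)\<^sup>2" and j: "j < d"
  defines "q \<equiv> real K / (real K + 2)"
  shows "2 * mu * profile q d (j + 1)
    + (L - mu) / 2 * (2 * profile q d (j + 1) - profile q d j - profile q d (j + 2)) = 0"
proof -
  have L: "L = mu * (real K + 1)\<^sup>2" unfolding mu by simp
  have Lmu: "L - mu = mu * (real K * (real K + 2))"
    unfolding L by (simp add: power2_eq_square algebra_simps)
  have char: "4 * q = real K * (real K + 2) * (1 - q)\<^sup>2"
  proof -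
    have "1 - q = 2 / (real K + 2)" unfolding q_def by (simp add: field_simps)
    then show ?thesis by (simp add: q_def power2_eq_square)
  qed
  have rec: "4 * q ^ (i + 1) = real K * (real K + 2) * (q ^ i + q ^ (i + 2) - 2 * q ^ (i + 1))" for i
  proof -
    have "4 * q ^ (i + 1) = q ^ i * (4 * q)" by simp
    also have "\<dots> = real K * (real K + 2) * (q ^ i + q ^ (i + 2) - 2 * q ^ (i + 1))"
      unfolding char by (simp add: power2_eq_square algebra_simps)
    finally show ?thesis .
  qed
  \<comment> \<open>Counting from the reflected end makes the three exponents \<open>i + 2\<close>,
    \<open>i + 1\<close>, \<open>i\<close>, without truncated subtraction because
    \<open>j < d\<close>.\<close>
  define i where "i = 2 * d - 1 - j"
  have e: "2 * d + 1 - j = i + 2" "2 * d + 1 - (j + 1) = i + 1" "2 * d + 1 - (j + 2) = i"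
    using j by (auto simp: i_def)
  have "4 * profile q d (j + 1) = real K * (real K + 2) *
      (profile q d j + profile q d (j + 2) - 2 * profile q d (j + 1))"
    unfolding profile_def e using rec[of i] rec[of j] by (simp only: distrib_left) (simp add: algebra_simps)
  moreover have "2 * mu * b + mu * X / 2 * (2 * b - a - c) = mu / 2 * (4 * b - X * (a + c - 2 * b))"
    for a b c X :: real
    by (simp add: field_simps)
  ultimately show ?thesis unfolding Lmu by (simp only:) simp
qed

text \<open>The constant comes from \<open>q\<^sup>-\<^sup>K = (1 + 2/K)\<^sup>K \<le> e\<^sup>2\<close>.\<close>

lemma profile_tail:
  fixes K :: nat
  assumes K: "1 \<le> K"
  defines "q \<equiv> real K / (real K + 2)"
  shows "(\<Sum>j<2 * K. (profile q (2 * K) (j + 1))\<^sup>2)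
    \<le> (1 + exp 4) * (\<Sum>j<K. (profile q (2 * K) (K + j + 1))\<^sup>2)"
proof -
  let ?p = "profile q (2 * K)"
  have q: "0 < q" "q \<le> 1" using K by (auto simp: q_def)
  have "1 / q = 1 + 2 / real K" using K by (simp add: q_def field_simps)
  also have "\<dots> \<le> exp (2 / real K)" using exp_ge_add_one_self[of "2 / real K"] .
  finally have "(1 / q) ^ K \<le> exp (2 / real K) ^ K" using q by (intro power_mono) auto
  also have "\<dots> = exp 2" using K by (simp flip: exp_of_nat_mult)
  finally have eq: "1 \<le> exp 2 * q ^ K" using q by (simp add: field_simps power_divide)
  have step: "?p (j + 1) \<le> exp 2 * ?p (K + j + 1)" if "j < K" for j
  proof -
    have e: "2 * (2 * K) + 1 - (j + 1) = (2 * (2 * K) + 1 - (K + j + 1)) + K"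
      using that by simp
    have "q ^ (j + 1) \<le> q ^ (j + 1) * (exp 2 * q ^ K)" using eq q by simp
    then have "q ^ (j + 1) \<le> exp 2 * q ^ (K + j + 1)"
      by (simp add: power_add algebra_simps)
    \<comment> \<open>The reflected power grows with \<open>j\<close>, so
      \<open>q ^ K \<le> 1\<close> suffices for it.\<close>
    moreover have "q ^ (2 * (2 * K) + 1 - (j + 1)) \<le> exp 2 * q ^ (2 * (2 * K) + 1 - (K + j + 1))"
    proof -
      have "q ^ K \<le> 1" using q by (simp add: power_le_one)
      also have "1 \<le> exp (2 :: real)" by simp
      finally show ?thesis
        unfolding e power_add using q by (simp add: mult.commute mult_left_mono)
    qed
    ultimately show ?thesis by (simp add: profile_def distrib_left)
  qed
  have "(?p (j + 1))\<^sup>2 \<le> exp 4 * (?p (K + j + 1))\<^sup>2" if "j < K" for j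
  proof -
    have "(?p (j + 1))\<^sup>2 \<le> (exp 2 * ?p (K + j + 1))\<^sup>2"
      using step[OF that] profile_pos[OF q(1)] by (intro power_mono) (auto simp: less_imp_le)
    then show ?thesis by (simp add: power_mult_distrib flip: exp_of_nat_mult)
  qed
  then have "(\<Sum>j<K. (?p (j + 1))\<^sup>2) \<le> (\<Sum>j<K. exp 4 * (?p (K + j + 1))\<^sup>2)"
    by (intro sum_mono) auto
  \<comment> \<open>The first half is at most \<open>exp 4\<close> times the second; the summand 1
    accounts for the second half itself.\<close>
  then show ?thesis
    unfolding mult_2 sum_lessThan_add by (simp add: sum_distrib_left distrib_right)
qed

section \<open>Normalisation, choice of parameters and the final estimate\<close>

lemma consensus_lower_bound:
  fixes L D :: real and N K k :: nat
  assumes L: "0 < L" and D: "0 < D" and N: "1 \<le> N" and K: "1 \<le> K" and k: "k < K * (N + 1) + 2"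
  defines "d \<equiv> 2 * K" and "mu \<equiv> L / (real K + 1)\<^sup>2"
    and "A \<equiv> consensus_mat N (2 * K)" and "m \<equiv> (2 * N - 1) * (2 * K)"
  obtains alpha xs ls where "0 < alpha"
    "constrained_quadratic (2 * N * d) (consensus_obj L mu alpha N d) (obj_grad L mu alpha N d)
      (obj_form L mu N d) L mu m A xs ls"
    "vnorm xs = D"
    "\<And>x. x \<in> reached N d k \<Longrightarrow> mu * D\<^sup>2 / (4 * (1 + exp 4)) \<le> obj_form L mu N d (x - xs)"
proof -
  define q where "q = real K / (real K + 2)"
  have q: "0 < q" using K by (simp add: q_def)
  have d: "0 < d" using K by (simp add: d_def)
  have mu: "0 < mu" using L by (simp add: mu_def)
  have "1\<^sup>2 \<le> (real K + 1)\<^sup>2" by (intro power_mono) auto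
  then have "L * 1 \<le> L * (real K + 1)\<^sup>2" using L by (intro mult_left_mono) auto
  then have muL: "mu \<le> L" using L unfolding mu_def by (simp add: divide_le_eq)
  define S where "S = (\<Sum>j<d. (profile q d (j + 1))\<^sup>2)"
  have S: "0 < S" unfolding S_def
  proof (rule sum_pos)
    show "0 < (profile q d (j + 1))\<^sup>2" for j using profile_pos[OF q, of d "j + 1"] by simp
  qed (use d in auto)
  \<comment> \<open>The solution consists of \<open>2 * N\<close> equal blocks of squared norm
    \<open>beta\<^sup>2 * S\<close>, so this factor gives it norm exactly \<open>D\<close>. The
    source strength is then the ghost value \<open>V 0\<close>.\<close>
  define beta where "beta = D / sqrt (2 * real N * S)"
  have beta: "0 < beta" using D N S by (simp add: beta_def)
  have beta2: "2 * real N * (beta\<^sup>2 * S) = D\<^sup>2" using N S by (simp add: beta_def power_divide)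
  define V where "V j = beta * profile q d j" for j
  have V0: "0 < V 0" using beta profile_pos[OF q] by (simp add: V_def)
  have rec: "2 * mu * V (j + 1) + (L - mu) / 2 * (2 * V (j + 1) - V j - V (j + 2)) = 0"
    if "j < d" for j
  proof -
    have "2 * mu * V (j + 1) + (L - mu) / 2 * (2 * V (j + 1) - V j - V (j + 2)) =
        beta * (2 * mu * profile q d (j + 1)
          + (L - mu) / 2 * (2 * profile q d (j + 1) - profile q d j - profile q d (j + 2)))"
      by (simp add: V_def algebra_simps)
    also have "\<dots> = 0"
      unfolding q_def using profile_recurrence[OF K, of mu L j d] that by (simp add: mu_def)
    finally show ?thesis .
  qed
  have "V d = V (d + 1)" unfolding V_def profile_free_end[of q d] ..
  then have "constrained_quadratic (2 * N * d) (consensus_obj L mu (V 0) N d) (obj_grad L mu (V 0) N d)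
      (obj_form L mu N d) L mu m A (consensus_vec N d V) (multiplier L mu N d V)"
    unfolding A_def m_def d_def[symmetric]
    using constrained_quadratic_consensus[OF N d mu muL rec] by blast
  moreover have "vnorm (consensus_vec N d V) = D"
  proof -
    have "consensus_vec N d V \<bullet> consensus_vec N d V = (\<Sum>r<2 * N * d. (V (r mod d + 1))\<^sup>2)"
      by (simp add: scalar_prod_lessThan[of _ "2 * N * d"] consensus_vec_def power2_eq_square)
    also have "\<dots> = 2 * real N * (beta\<^sup>2 * S)"
      unfolding sum_periodic[of "\<lambda>j. (V (j + 1))\<^sup>2"]
      by (simp add: V_def S_def power_mult_distrib sum_distrib_left)
    finally show ?thesis using D by (simp add: beta2 vnorm_def)
  qed
  moreover have "mu * D\<^sup>2 / (4 * (1 + exp 4)) \<le> obj_form L mu N d (x - consensus_vec N d V)"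
    if x: "x \<in> reached N d k" for x
  proof -
    define T where "T = (\<Sum>j<K. (profile q d (K + j + 1))\<^sup>2)"
    have e: "0 < 1 + exp (4 :: real)" by (simp add: add_pos_pos)
    have "S \<le> (1 + exp 4) * T"
      unfolding S_def T_def d_def q_def using profile_tail[OF K] .
    \<comment> \<open>The factor is \<open>mu / 4\<close> rather than \<open>mu / 2\<close> because
      the last \<open>N\<close> of the \<open>2 * N\<close> equal blocks carry half of
      \<open>D\<^sup>2\<close>.\<close>
    then have "mu / 4 * (2 * real N * (beta\<^sup>2 * S)) \<le> mu / 4 * (2 * real N * (beta\<^sup>2 * ((1 + exp 4) * T)))"
      using mu by (intro mult_left_mono) auto
    also have "\<dots> = (1 + exp 4) * (mu / 2 * (real N * (beta\<^sup>2 * T)))" by simp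
    finally have "mu * D\<^sup>2 / 4 \<le> (1 + exp 4) * (mu / 2 * (real N * (beta\<^sup>2 * T)))"
      unfolding beta2 by simp
    then have "mu * D\<^sup>2 / (4 * (1 + exp 4)) \<le> mu / 2 * (real N * (beta\<^sup>2 * T))"
      using e by (simp add: field_simps)
    also have "beta\<^sup>2 * T = (\<Sum>j<K. (V (K + j + 1))\<^sup>2)"
      by (simp add: T_def V_def power_mult_distrib sum_distrib_left)
    also have "mu / 2 * (real N * (\<Sum>j<K. (V (K + j + 1))\<^sup>2)) \<le> obj_form L mu N d (x - consensus_vec N d V)"
      by (rule obj_form_reached_ge[OF meta_eq_to_obj_eq[OF d_def] K k mu muL x])
    finally show ?thesis .
  qed
  ultimately show thesis using that[OF V0] by blast
qed

text \<open>Rounding \<open>N\<close> down keeps the condition number admissible, and the 1 added in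
  \<open>K\<close> makes \<open>k\<close> iterations too few to pass coordinate \<open>K\<close>.
  For the rate, \<open>N + 1\<close> exceeds \<open>kappa / 2\<close>, so \<open>K\<close> is at
  most about \<open>2 * k / kappa\<close>; the rounding excess \<open>2 * kappa\<close> is absorbed
  by \<open>kappa \<le> k\<close>.\<close>

lemma parameter_bounds:
  fixes kappa :: real and k :: nat
  assumes kappa: "1 \<le> kappa" and k: "2 \<le> k" "kappa \<le> real k"
  defines "N \<equiv> nat \<lfloor>(kappa + 1) / 2\<rfloor>"
  defines "K \<equiv> nat \<lfloor>(real k - 2) / (real N + 1)\<rfloor> + 1"
  shows "1 \<le> N" "2 * real N - 1 \<le> kappa" "k < K * (N + 1) + 2" "kappa * (real K + 1) \<le> 4 * real k"
proof -
  have "1 \<le> \<lfloor>(kappa + 1) / 2\<rfloor>" using kappa by (simp add: le_floor_iff)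
  then have N: "1 \<le> N" and N_eq: "real N = of_int \<lfloor>(kappa + 1) / 2\<rfloor>"
    unfolding N_def by linarith+
  have N_le: "real N \<le> (kappa + 1) / 2" and N_gt: "(kappa + 1) / 2 < real N + 1"
    unfolding N_eq by linarith+
  show "1 \<le> N" by fact
  show "2 * real N - 1 \<le> kappa" using N_le by simp
  define t where "t = (real k - 2) / (real N + 1)"
  have t: "0 \<le> t" using k by (simp add: t_def)
  then have K_eq: "real K = of_int \<lfloor>t\<rfloor> + 1" by (simp add: K_def t_def)
  have K_gt: "t < real K" and K_le: "real K \<le> t + 1" unfolding K_eq by linarith+
  have "real k - 2 < real K * (real N + 1)" using K_gt by (simp add: t_def divide_less_eq)
  then have "real k < real (K * (N + 1) + 2)" by (simp add: algebra_simps)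
  then show "k < K * (N + 1) + 2" by (simp only: of_nat_less_iff)
  have "kappa / 2 * t \<le> (real N + 1) * t" using N_gt t by (intro mult_right_mono) auto
  also have "\<dots> = real k - 2" by (simp add: t_def)
  finally have "kappa * t \<le> 2 * real k - 4" by simp
  moreover have "kappa * (real K + 1) \<le> kappa * (t + 2)" using K_le kappa by (intro mult_left_mono) auto
  ultimately show "kappa * (real K + 1) \<le> 4 * real k" using k by (simp add: distrib_left)
qed

theorem theorem6:
  "\<exists>c0::real. c0 > 0 \<and>
    (\<forall>(Lf::real) (D::real) (kappa::real) (k::nat).
      Lf > 0 \<and> D > 0 \<and> kappa \<ge> 1 \<and> real k \<ge> kappa \<and> k \<ge> 2 \<longrightarrow>
      (let N = nat \<lfloor>(kappa + 1) / 2\<rfloor>;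
           K = nat \<lfloor>(real k - 2) / (real N + 1)\<rfloor> + 1;
           d = 2 * K;
           mu = Lf / (real K + 1)^2;
           A = consensus_mat N d;
           b = 0\<^sub>v ((2 * N - 1) * d);
           h = indicator_zero ((2 * N - 1) * d)
       in \<exists>alpha>0. let f = consensus_obj Lf mu alpha N d in
            class_FC Lf kappa D f h A b (0\<^sub>v (2 * N * d)) \<and>
            (\<exists>xs ls.
               (\<forall>y. is_solution f h A b y \<longleftrightarrow> y = xs) \<and>
               (\<forall>l. is_dual_solution f A b l \<longleftrightarrow> l = ls) \<and>
               A\<^sup>T *\<^sub>v ls = grad (2 * N * d) f xs \<and>
               (\<forall>x. linear_span_iterates f A b x \<longrightarrow>
                  f (x k) - f xs - ls \<bullet> (A *\<^sub>v x k - b) \<ge> c0 * (kappa^2 * Lf * D^2 / (real k)^2)))))"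
proof (intro exI[of _ "1 / (64 * (1 + exp 4))"] conjI allI impI)
  fix Lf D kappa :: real and k :: nat
  assume asm: "Lf > 0 \<and> D > 0 \<and> kappa \<ge> 1 \<and> real k \<ge> kappa \<and> k \<ge> 2"
  define N where "N = nat \<lfloor>(kappa + 1) / 2\<rfloor>"
  define K where "K = nat \<lfloor>(real k - 2) / (real N + 1)\<rfloor> + 1"
  define d where "d = 2 * K"
  define mu where "mu = Lf / (real K + 1)\<^sup>2"
  define A where "A = consensus_mat N d"
  define m where "m = (2 * N - 1) * d"
  have N: "1 \<le> N" and N_le: "2 * real N - 1 \<le> kappa" and k: "k < K * (N + 1) + 2"
    and K_le: "kappa * (real K + 1) \<le> 4 * real k"
    using parameter_bounds[of kappa k] asm unfolding N_def K_def by auto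
  have K: "1 \<le> K" and d: "0 < d" by (simp_all add: K_def d_def)
  obtain alpha xs ls where alpha: "0 < alpha"
    and cq: "constrained_quadratic (2 * N * d) (consensus_obj Lf mu alpha N d)
      (obj_grad Lf mu alpha N d) (obj_form Lf mu N d) Lf mu m A xs ls"
    and nrm: "vnorm xs = D"
    and low: "\<And>x. x \<in> reached N d k \<Longrightarrow> mu * D\<^sup>2 / (4 * (1 + exp 4)) \<le> obj_form Lf mu N d (x - xs)"
    using consensus_lower_bound[of Lf D N K k] asm N K k unfolding A_def m_def mu_def d_def by blast
  interpret constrained_quadratic "2 * N * d" "consensus_obj Lf mu alpha N d"
      "obj_grad Lf mu alpha N d" "obj_form Lf mu N d" Lf mu m A xs ls
    by (rule cq)
  let ?f = "consensus_obj Lf mu alpha N d" and ?h = "indicator_zero m" and ?b = "0\<^sub>v m :: real vec"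
  have "vnorm (0\<^sub>v (2 * N * d) - xs) = vnorm (xs - 0\<^sub>v (2 * N * d))"
    using scalar_prod_diff_self[OF zero_carrier_vec xs_carrier] by (simp add: vnorm_def)
  also have "\<dots> = D" using xs_carrier nrm by simp
  finally have dist: "vnorm (0\<^sub>v (2 * N * d) - xs) \<le> D" by simp
  have "cond_number A \<le> ereal (2 * real N - 1)"
    unfolding A_def by (rule cond_number_consensus_mat[OF N d])
  also have "\<dots> \<le> ereal kappa" using N_le by simp
  finally have cond: "cond_number A \<le> ereal kappa" .
  have cls: "class_FC Lf kappa D ?f ?h A ?b (0\<^sub>v (2 * N * d))"
    unfolding class_FC_def dims
    using convex smooth proper_indicator_zero closed_indicator_zero convex_indicator_zero cond
      solution_iff dist by auto
  have gap: "1 / (64 * (1 + exp 4)) * (kappa\<^sup>2 * Lf * D\<^sup>2 / (real k)\<^sup>2)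
      \<le> ?f (x k) - ?f xs - ls \<bullet> (A *\<^sub>v x k - ?b)" if "linear_span_iterates ?f A ?b x" for x
  proof -
    have xk: "x k \<in> reached N d k"
      using iterates_reached[OF N d grad_eq] that unfolding A_def m_def by blast
    then have xc: "x k \<in> carrier_vec (2 * N * d)" by (simp add: reached_def)
    have const: "Lf * D\<^sup>2 * (kappa\<^sup>2 / (16 * (real k)\<^sup>2)) / (4 * e)
        = 1 / (64 * e) * (kappa\<^sup>2 * Lf * D\<^sup>2 / (real k)\<^sup>2)" for e :: real
      by (simp add: ac_simps)
    \<comment> \<open>Squaring turns the bound on \<open>K\<close> into
      \<open>mu \<ge> Lf * kappa\<^sup>2 / (16 * k\<^sup>2)\<close>. This 16 and the 4 from the
      quadratic form make up the 64 of the constant.\<close>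
    have "(kappa * (real K + 1))\<^sup>2 \<le> (4 * real k)\<^sup>2"
      using K_le asm by (intro power_mono) auto
    then have "kappa\<^sup>2 / (16 * (real k)\<^sup>2) \<le> 1 / (real K + 1)\<^sup>2"
      using asm by (simp add: power_mult_distrib divide_le_eq le_divide_eq)
    then have "Lf * D\<^sup>2 * (kappa\<^sup>2 / (16 * (real k)\<^sup>2)) \<le> Lf * D\<^sup>2 * (1 / (real K + 1)\<^sup>2)"
      using asm by (intro mult_left_mono) auto
    then have "Lf * D\<^sup>2 * (kappa\<^sup>2 / (16 * (real k)\<^sup>2)) / (4 * (1 + exp 4)) \<le> mu * D\<^sup>2 / (4 * (1 + exp 4))"
      by (intro divide_right_mono) (auto simp: mu_def add_nonneg_nonneg)
    also have "Lf * D\<^sup>2 * (kappa\<^sup>2 / (16 * (real k)\<^sup>2)) / (4 * (1 + exp 4))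
        = 1 / (64 * (1 + exp 4)) * (kappa\<^sup>2 * Lf * D\<^sup>2 / (real k)\<^sup>2)"
      by (rule const)
    also note low[OF xk]
    also have "obj_form Lf mu N d (x k - xs) = ?f (x k) - ?f xs - ls \<bullet> (A *\<^sub>v x k - ?b)"
      using lagrangian_gap[OF xc] mult_A_carrier[OF xc] by simp
    finally show ?thesis .
  qed
  show "let N = nat \<lfloor>(kappa + 1) / 2\<rfloor>;
           K = nat \<lfloor>(real k - 2) / (real N + 1)\<rfloor> + 1;
           d = 2 * K;
           mu = Lf / (real K + 1)^2;
           A = consensus_mat N d;
           b = 0\<^sub>v ((2 * N - 1) * d);
           h = indicator_zero ((2 * N - 1) * d)
       in \<exists>alpha>0. let f = consensus_obj Lf mu alpha N d in
            class_FC Lf kappa D f h A b (0\<^sub>v (2 * N * d)) \<and>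
            (\<exists>xs ls.
               (\<forall>y. is_solution f h A b y \<longleftrightarrow> y = xs) \<and>
               (\<forall>l. is_dual_solution f A b l \<longleftrightarrow> l = ls) \<and>
               A\<^sup>T *\<^sub>v ls = grad (2 * N * d) f xs \<and>
               (\<forall>x. linear_span_iterates f A b x \<longrightarrow>
                  f (x k) - f xs - ls \<bullet> (A *\<^sub>v x k - b)
                    \<ge> 1 / (64 * (1 + exp 4)) * (kappa^2 * Lf * D^2 / (real k)^2)))"
    unfolding Let_def N_def[symmetric] K_def[symmetric] d_def[symmetric] mu_def[symmetric]
      A_def[symmetric] m_def[symmetric]
  proof (rule exI[of _ alpha], intro conjI alpha cls, rule exI[of _ xs], rule exI[of _ ls],
      intro conjI allI impI)
    show "is_solution ?f ?h A ?b y \<longleftrightarrow> y = xs" for y by (rule solution_iff)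
    show "is_dual_solution ?f A ?b l \<longleftrightarrow> l = ls" for l by (rule dual_solution_iff)
    show "A\<^sup>T *\<^sub>v ls = grad (2 * N * d) ?f xs" by (simp add: stationary grad_eq xs_carrier)
  qed (rule gap)
qed (simp add: add_pos_pos)

end
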